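(* Let $d\geq 2$, $\gamma>0$ and $0\leq\lambda\leq 1$. For $h\ge 0$ let $\ell(h)$ be a geodesic segment of hyperbolic length $h$ in $\mathbb{H}^d$ starting at $o$. Then $$\mu_{\gamma,\lambda}([\ell(h)]_\lambda)=\gamma\,\frac{\Gamma(\frac{d}{2})}{2\sqrt{\pi}\,\Gamma(\frac{d+1}{2})}\,h,\qquad h\geq 0.$$
   Context: $\mathbb{H}^d$ is $d$-dimensional hyperbolic space of constant curvature $-1$, realised as the Poincaré ball: the open Euclidean unit ball $\mathbb{B}^d$ with Riemannian metric $\frac{4}{(1-\|y\|^2)^2}\,dy^2$; $o=0$ is its centre, and the hyperbolic distance from $o$ to $y$ is $2\,\mathrm{artanh}\|y\|$. For $\lambda\in[0,1]$, a $\lambda$-geodesic hyperplane is a complete totally umbilical hypersurface of $\mathbb{H}^d$ with normal curvature $\lambda$. $\mathrm{Hyp}_\lambda^o$ is the space of those for which $o$ does not lie on the convex side. Its elements are parametrised by $(r,u)\in(0,1)\times\mathbb{S}^{d-1}$, with $r$ the Euclidean distance from $o$: with $R=\frac{1-r^2}{2(\lambda+r)}$, $$H(r,u)=\{x\in\mathbb{B}^d:\|x-(r+R)u\|=R\}.$$ The measure $\mu_{\gamma,\lambda}$ on $\mathrm{Hyp}_\lambda^o$ is $$\mu_{\gamma,\lambda}(\,\cdot\,)=\gamma\int_0^1\int_{\mathbb{S}^{d-1}}\mathbf{1}\{H(r,u)\in\cdot\,\}\,\frac{2(1+2\lambda r+r^2)^{d-1}}{(1-r^2)^d}\,\sigma_{d-1}(du)\,dr,$$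 where $\sigma_{d-1}$ is the normalised (probability) surface measure on $\mathbb{S}^{d-1}$. (Equivalently, with $s=2\,\mathrm{artanh}(r)$ the hyperbolic distance, the density is $\gamma(\cosh s+\lambda\sinh s)^{d-1}$ with respect to $ds\,\sigma_{d-1}(du)$.) For a closed set $A\subset\mathbb{H}^d$, $[A]_\lambda:=\{H\in\mathrm{Hyp}_\lambda^o: H\cap A\neq\varnothing\}$. *)

theory Defs
  imports "HOL-Analysis.Analysis"
begin

text \<open>Hyperbolic space is the open unit ball of a Euclidean space \<^typ>\<open>'a\<close> of dimension
  \<open>d = DIM('a)\<close>, with the Riemannian metric \<open>4 / (1 - \<parallel>y\<parallel>\<^sup>2)\<^sup>2 dy\<^sup>2\<close>.\<close>

abbreviation hyp_space :: "'a::euclidean_space set" where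
  "hyp_space \<equiv> ball 0 1"

definition hyp_length :: "(real \<Rightarrow> 'a::euclidean_space) \<Rightarrow> real" where
  "hyp_length p =
     integral {0..1} (\<lambda>t. 2 / (1 - (norm (p t))\<^sup>2) * norm (vector_derivative p (at t)))"

text \<open>The paths are \<open>C\<^sup>1\<close> on the closed interval, so the integrand above is continuous; their
  velocity may vanish, so allowing piecewise \<open>C\<^sup>1\<close> paths would not change the infimum.\<close>

definition hyp_dist :: "'a::euclidean_space \<Rightarrow> 'a \<Rightarrow> real" where
  "hyp_dist x y =
     Inf {hyp_length p | p. p C1_differentiable_on {0..1} \<and> p ` {0..1} \<subseteq> hyp_space \<and>
                            p 0 = x \<and> p 1 = y}"

definition geodesic_segment_from :: "'a::euclidean_space \<Rightarrow> real \<Rightarrow> 'a set \<Rightarrow> bool" where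
  "geodesic_segment_from x h A \<longleftrightarrow>
     (\<exists>c. c 0 = x \<and> c ` {0..h} = A \<and> A \<subseteq> hyp_space \<and>
          (\<forall>s\<in>{0..h}. \<forall>t\<in>{0..h}. hyp_dist (c s) (c t) = \<bar>s - t\<bar>))"

text \<open>For \<open>0 < r < 1\<close> and a unit vector \<open>u\<close>: the part in the ball of the Euclidean sphere that
  meets the boundary sphere so as to have normal curvature \<open>lam\<close>, lies at Euclidean distance
  \<open>r\<close> from the centre in direction \<open>u\<close>, and does not have the centre on its convex side.\<close>

definition hyperplane :: "real \<Rightarrow> real \<Rightarrow> 'a::euclidean_space \<Rightarrow> 'a set" where
  "hyperplane lam r u =
     (let R = (1 - r\<^sup>2) / (2 * (lam + r))
      in {x \<in> hyp_space. norm (x - (r + R) *\<^sub>R u) = R})"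

definition Hyp :: "real \<Rightarrow> 'a::euclidean_space set set" where
  "Hyp lam = {hyperplane lam r u | r u. r \<in> {0<..<1} \<and> u \<in> sphere 0 1}"

definition hits :: "real \<Rightarrow> 'a::euclidean_space set \<Rightarrow> 'a set set" where
  "hits lam A = {H \<in> Hyp lam. H \<inter> A \<noteq> {}}"

text \<open>The normalised surface measure of a Borel subset of the unit sphere is the normalised
  volume of the cone over it in the unit ball, that is, the law of the direction of a
  uniformly distributed point of the ball.\<close>

definition sphere_measure :: "'a::euclidean_space measure" where
  "sphere_measure =
     restrict_space (distr (uniform_measure lborel (ball 0 1)) borel sgn) (sphere 0 1)"

text \<open>The Borel \<open>\<sigma>\<close>-algebra of the Fell topology on closed subsets of hyperbolic space,
  restricted to the space of hyperplanes: it is generated by the families of closed sets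
  hitting a given compact set.\<close>

definition hyp_sigma :: "real \<Rightarrow> 'a::euclidean_space set measure" where
  "hyp_sigma lam = sigma (Hyp lam) {hits lam C | C. compact C \<and> C \<subseteq> hyp_space}"

text \<open>By Tonelli, the value on a measurable family \<open>\<A>\<close> is
  \<open>\<gamma> \<integral>\<^sub>0\<^sup>1 \<integral> 1{H(r, u) \<in> \<A>} 2 (1 + 2 lam r + r\<^sup>2)\<^bsup>d-1\<^esup> / (1 - r\<^sup>2)\<^bsup>d\<^esup> \<sigma>(du) dr\<close>.\<close>

definition hyperplane_measure :: "real \<Rightarrow> real \<Rightarrow> 'a::euclidean_space set measure" where
  "hyperplane_measure \<gamma> lam =
     distr
       (density (restrict_space lborel {0<..<1} \<Otimes>\<^sub>M sphere_measure)
          (\<lambda>(r, u). ennreal (\<gamma> * (2 * (1 + 2 * lam * r + r\<^sup>2) ^ (DIM('a) - 1)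
                                    / (1 - r\<^sup>2) ^ DIM('a)))))
       (hyp_sigma lam)
       (\<lambda>(r, u). hyperplane lam r u)"

end

theory Submission
  imports Defs
begin

text \<open>Write \<open>d = n + 1\<close>. A geodesic segment of length \<open>h\<close> from the centre is a radial segment
  \<open>{t v | 0 \<le> t \<le> rho}\<close> with \<open>v\<close> a unit vector and \<open>rho = tanh (h / 2)\<close>
  (\<open>geodesic_segment_from_origin\<close>). The convex side of a hyperplane meets a geodesic in an
  interval. Hence a hyperplane that does not have the centre on its convex side meets the segment
  exactly if the segment enters the closed convex side somewhere, and then there is only one point
  of entry. The isometry-invariant measure on all hyperplanes with a given curvature restricts to
  the measure considered here, so the points of entry should occur at a constant rate
  per unit of hyperbolic length. This is why the answer is linear in \<open>h\<close>.

  The proof makes this explicit by a change of variables. Replace \<open>(r, u)\<close> by the parameter \<open>t\<close>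
  of the point of entry \<open>t v\<close> and the cosine \<open>a\<close> of the angle between the segment and the inward
  normal there. Let \<open>c = u \<bullet> v\<close> and let \<open>q\<close> be the quotient of the Euclidean distance from the
  origin to the centre of the sphere carrying the hyperplane by the radius of that sphere. The
  cosine \<open>c\<close> has a density proportional to \<open>(1 - c\<^sup>2) powr ((n - 2) / 2)\<close> under the surface
  measure (\<open>emeasure_sphere_cap\<close>, \<open>cap_volume_has_derivative\<close>), and the measure on the
  hyperplanes has density \<open>2 q ^ n / (1 - r\<^sup>2)\<close> in \<open>r\<close>. The law of sines gives
  \<open>1 - c\<^sup>2 = (1 - a\<^sup>2) / q\<^sup>2\<close>, and the two partial derivatives are
  \<open>dc/dt = - a / (t q)\<close> for fixed \<open>r\<close> and \<open>da/dr = (1 - t\<^sup>2) q / (t (1 - r\<^sup>2))\<close> for fixed \<open>t\<close>.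
  All powers of \<open>q\<close> cancel (\<open>weighted_cap_density\<close>), and what remains is the product of
  \<open>2 / (1 - t\<^sup>2) dt\<close>, the element of hyperbolic length, and a multiple of
  \<open>a (1 - a\<^sup>2) powr ((n - 2) / 2) da\<close>, in which the curvature no longer occurs. The integral over
  \<open>a\<close> from 0 to 1 is the constant in the theorem (\<open>crossing_density_integral\<close>), and the integral
  over \<open>t\<close> is \<open>h\<close> (\<open>hitting_integral\<close>).\<close>

section \<open>Radial geodesics\<close>

text \<open>The Busemann function of the boundary point \<open>v\<close>, normalised to vanish at the centre. Its
  hyperbolic gradient has length 1 everywhere, which makes differences of its values lower bounds
  for the distance. These bounds are sharp enough to recognise the radial geodesics.\<close>

definition busemann :: "'a::euclidean_space \<Rightarrow> 'a \<Rightarrow> real" where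
  "busemann v x = ln ((norm (v - x))\<^sup>2 / (1 - (norm x)\<^sup>2))"

text \<open>The vector is the Euclidean gradient of \<open>busemann v\<close> at \<open>x\<close>, and the right-hand side is the
  conformal factor of the metric. The square of the left-hand side involves \<open>x\<close> and \<open>v\<close> only
  through \<open>norm x\<close> and \<open>norm (v - x)\<close>, and the latter cancels.\<close>

lemma busemann_gradient_norm:
  fixes v x :: "'a::euclidean_space"
  assumes "norm v = 1" and "norm x < 1"
  shows "norm ((2 / (norm (v - x))\<^sup>2) *\<^sub>R (x - v) + (2 / (1 - (norm x)\<^sup>2)) *\<^sub>R x)
           = 2 / (1 - (norm x)\<^sup>2)"
proof -
  define q where "q = x \<bullet> x"
  define N where "N = (v - x) \<bullet> (v - x)"
  have q: "(norm x)\<^sup>2 = q" and N: "(norm (v - x))\<^sup>2 = N"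
    by (simp_all add: q_def N_def power2_norm_eq_inner)
  have q1: "q < 1"
    using assms(2) unfolding q[symmetric] by (simp add: power_less_one_iff)
  have Npos: "N > 0"
    using assms unfolding N[symmetric] by auto
  have "v \<bullet> v = 1"
    using assms(1) by (simp add: power2_norm_eq_inner[symmetric])
  then have cross: "(x - v) \<bullet> x = (N - (1 - q)) / 2"
    by (simp add: N_def q_def inner_diff_left inner_diff_right inner_commute)
  have self: "(x - v) \<bullet> (x - v) = N"
    by (simp add: N_def inner_diff_left inner_diff_right inner_commute)
  have expand: "(norm (a *\<^sub>R y + b *\<^sub>R x))\<^sup>2 = a\<^sup>2 * (y \<bullet> y) + 2 * a * b * (y \<bullet> x) + b\<^sup>2 * (x \<bullet> x)"
    for a b :: real and y :: 'a
    unfolding power2_norm_eq_inner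
    by (simp add: inner_add_left inner_add_right inner_commute[of x y] power2_eq_square distrib_left)
  have "(norm ((2 / N) *\<^sub>R (x - v) + (2 / (1 - q)) *\<^sub>R x))\<^sup>2
      = (2 / N)\<^sup>2 * ((x - v) \<bullet> (x - v)) + 2 * (2 / N) * (2 / (1 - q)) * ((x - v) \<bullet> x)
          + (2 / (1 - q))\<^sup>2 * (x \<bullet> x)"
    by (rule expand)
  also have "\<dots> = (2 / N)\<^sup>2 * N + 2 * (2 / N) * (2 / (1 - q)) * ((N - (1 - q)) / 2)
          + (2 / (1 - q))\<^sup>2 * q"
    by (simp only: cross self q_def)
  also have "\<dots> = (2 / (1 - q))\<^sup>2"
  proof -
    define e where "e = 1 - q"
    have "e > 0" "q = 1 - e"
      using q1 by (auto simp: e_def)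
    then have "2 * (2 / N) * (2 / e) * ((N - e) / 2) = 4 / e - 4 / N" "(2 / N)\<^sup>2 * N = 4 / N"
      "(2 / e)\<^sup>2 * q = (2 / e)\<^sup>2 - 4 / e"
      using Npos by (auto simp: field_simps power2_eq_square)
    then show ?thesis
      unfolding e_def by linarith
  qed
  finally show ?thesis
    unfolding q N using q1 by (simp add: power2_eq_iff_nonneg)
qed

text \<open>The derivative of \<open>busemann v\<close> along a path is bounded by the integrand of the length.\<close>

lemma busemann_le_hyp_length:
  fixes v :: "'a::euclidean_space"
  assumes v: "norm v = 1"
    and p: "p C1_differentiable_on {0..1}" and ball: "p ` {0..1} \<subseteq> hyp_space"
  shows "busemann v (p 0) - busemann v (p 1) \<le> hyp_length p"
proof -
  obtain D where D: "\<And>t. t \<in> {0..1} \<Longrightarrow> (p has_vector_derivative D t) (at t)"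
    and contD: "continuous_on {0..1} D"
    using p unfolding C1_differentiable_on_def by blast
  have contp: "continuous_on {0..1} p"
    using p by (rule C1_differentiable_imp_continuous_on)
  have n1: "norm (p t) < 1" if "t \<in> {0..1}" for t
  proof -
    have "p t \<in> hyp_space"
      using ball that by blast
    then show ?thesis by simp
  qed
  have sq: "(norm (p t))\<^sup>2 < 1" if "t \<in> {0..1}" for t
    using n1[OF that] by (simp add: power_less_one_iff)
  have nv: "v \<noteq> p t" if "t \<in> {0..1}" for t
    using n1[OF that] v by auto
  define G where "G t = (2 / (norm (v - p t))\<^sup>2) *\<^sub>R (p t - v) + (2 / (1 - (norm (p t))\<^sup>2)) *\<^sub>R p t" for t
  have deriv: "((\<lambda>t. busemann v (p t)) has_vector_derivative G t \<bullet> D t) (at t within {0..1})"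
    if t: "t \<in> {0..1}" for t
  proof -
    have D': "(p has_derivative (\<lambda>y. y *\<^sub>R D t)) (at t within {0..1})"
      using D[OF t] has_vector_derivative_at_within unfolding has_vector_derivative_def by blast
    have pos: "(v - p t) \<bullet> (v - p t) > 0" "1 - p t \<bullet> p t > 0"
      using nv[OF t] sq[OF t] by (auto simp: power2_norm_eq_inner)
    have "((\<lambda>t. (v - p t) \<bullet> (v - p t)) has_real_derivative 2 * ((p t - v) \<bullet> D t)) (at t within {0..1})"
      unfolding has_field_derivative_def
      by (rule derivative_eq_intros D' refl)+
         (simp add: fun_eq_iff inner_diff_left inner_diff_right inner_commute distrib_left right_diff_distrib left_diff_distrib mult_ac)
    moreover have "((\<lambda>t. 1 - p t \<bullet> p t) has_real_derivative - 2 * (p t \<bullet> D t)) (at t within {0..1})"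
      unfolding has_field_derivative_def
      by (rule derivative_eq_intros D' refl)+ (simp add: fun_eq_iff inner_commute)
    ultimately have "((\<lambda>t. ln ((v - p t) \<bullet> (v - p t)) - ln (1 - p t \<bullet> p t)) has_real_derivative
        1 / ((v - p t) \<bullet> (v - p t)) * (2 * ((p t - v) \<bullet> D t))
          - 1 / (1 - p t \<bullet> p t) * (- 2 * (p t \<bullet> D t))) (at t within {0..1})"
      by (intro DERIV_diff DERIV_chain2[OF DERIV_ln_divide] pos)
    also have "1 / ((v - p t) \<bullet> (v - p t)) * (2 * ((p t - v) \<bullet> D t))
          - 1 / (1 - p t \<bullet> p t) * (- 2 * (p t \<bullet> D t)) = G t \<bullet> D t"
      by (simp add: G_def power2_norm_eq_inner inner_add_left)
    finally have "((\<lambda>t. ln ((v - p t) \<bullet> (v - p t)) - ln (1 - p t \<bullet> p t)) has_derivative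
            (\<lambda>y. y *\<^sub>R (G t \<bullet> D t))) (at t within {0..1})"
      unfolding has_real_derivative_iff_has_vector_derivative has_vector_derivative_def .
    then show ?thesis
      unfolding has_vector_derivative_def
    proof (rule has_derivative_transform_within[OF _ zero_less_one t])
      fix s assume "s \<in> {0..1::real}" "dist s t < 1"
      then show "ln ((v - p s) \<bullet> (v - p s)) - ln (1 - p s \<bullet> p s) = busemann v (p s)"
        using nv[of s] sq[of s]
        by (simp add: busemann_def power2_norm_eq_inner ln_div)
    qed
  qed
  have int: "((\<lambda>t. G t \<bullet> D t) has_integral busemann v (p 1) - busemann v (p 0)) {0..1}"
    by (rule fundamental_theorem_of_calculus) (use deriv in auto)
  then have neg: "((\<lambda>t. - (G t \<bullet> D t)) has_integral busemann v (p 0) - busemann v (p 1)) {0..1}"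
    using has_integral_neg[OF int] by simp
  have "continuous_on {0..1} (\<lambda>t. 2 / (1 - (norm (p t))\<^sup>2) * norm (D t))"
    by (intro continuous_intros contp contD) (use sq in force)
  then have "((\<lambda>t. 2 / (1 - (norm (p t))\<^sup>2) * norm (D t)) has_integral
      integral {0..1} (\<lambda>t. 2 / (1 - (norm (p t))\<^sup>2) * norm (D t))) {0..1}"
    using integrable_continuous_interval integrable_integral by blast
  moreover have "integral {0..1} (\<lambda>t. 2 / (1 - (norm (p t))\<^sup>2) * norm (D t)) = hyp_length p"
    unfolding hyp_length_def
    by (intro integral_cong) (use D vector_derivative_at in force)
  ultimately have len: "((\<lambda>t. 2 / (1 - (norm (p t))\<^sup>2) * norm (D t)) has_integral hyp_length p) {0..1}"
    by simp
  show ?thesis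
  proof (rule has_integral_le[OF neg len])
    fix t :: real assume t: "t \<in> {0..1}"
    have "- (G t \<bullet> D t) \<le> norm (G t) * norm (D t)"
      using Cauchy_Schwarz_ineq2[of "G t" "D t"] by linarith
    also have "norm (G t) = 2 / (1 - (norm (p t))\<^sup>2)"
      unfolding G_def by (rule busemann_gradient_norm[OF v n1[OF t]])
    finally show "- (G t \<bullet> D t) \<le> 2 / (1 - (norm (p t))\<^sup>2) * norm (D t)" .
  qed
qed

lemma linepath_C1_in_hyp_space:
  fixes x y :: "'a::euclidean_space"
  assumes "x \<in> hyp_space" and "y \<in> hyp_space"
  shows "linepath x y C1_differentiable_on {0..1}" and "linepath x y ` {0..1} \<subseteq> hyp_space"
proof -
  show "linepath x y C1_differentiable_on {0..1}"
    unfolding C1_differentiable_on_def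
    by (rule exI[of _ "\<lambda>_. y - x"]) (auto intro: has_vector_derivative_linepath_within)
  have "closed_segment x y \<subseteq> hyp_space"
    using assms convex_ball by (intro closed_segment_subset) auto
  then show "linepath x y ` {0..1} \<subseteq> hyp_space"
    by (simp add: path_image_linepath[unfolded path_image_def])
qed

lemma busemann_le_hyp_dist:
  fixes v x y :: "'a::euclidean_space"
  assumes v: "norm v = 1" and xy: "x \<in> hyp_space" "y \<in> hyp_space"
  shows "busemann v x - busemann v y \<le> hyp_dist x y"
  unfolding hyp_dist_def
proof (rule cInf_greatest)
  show "{hyp_length p |p. p C1_differentiable_on {0..1} \<and> p ` {0..1} \<subseteq> hyp_space \<and> p 0 = x \<and> p 1 = y} \<noteq> {}"
    using linepath_C1_in_hyp_space[OF xy] by (auto simp: linepath_def intro!: exI[of _ "linepath x y"])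
  fix l assume "l \<in> {hyp_length p |p. p C1_differentiable_on {0..1} \<and> p ` {0..1} \<subseteq> hyp_space \<and> p 0 = x \<and> p 1 = y}"
  then obtain p where p: "l = hyp_length p" "p C1_differentiable_on {0..1}" "p ` {0..1} \<subseteq> hyp_space"
    "p 0 = x" "p 1 = y"
    by blast
  show "busemann v x - busemann v y \<le> l"
    using busemann_le_hyp_length[OF v p(2,3)] p(1,4,5) by simp
qed

lemma unit_vector_along:
  fixes x :: "'a::euclidean_space"
  obtains u :: 'a where "norm u = 1" and "x = norm x *\<^sub>R u"
proof (cases "x = 0")
  case True
  show ?thesis
    by (rule that[of "SOME i. i \<in> Basis"]) (use True in \<open>simp_all add: SOME_Basis\<close>)
next
  case False
  then show ?thesis
    by (intro that[of "sgn x"]) (simp_all add: norm_sgn sgn_div_norm)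
qed

lemma hyp_dist_origin_le:
  fixes x :: "'a::euclidean_space"
  assumes x: "x \<in> hyp_space"
  shows "hyp_dist 0 x \<le> 2 * artanh (norm x)"
proof -
  define b where "b = norm x"
  have b: "0 \<le> b" "b < 1"
    using x by (auto simp: b_def)
  obtain v :: 'a where v: "norm v = 1"
    by (rule unit_vector_along[of 0])
  have "hyp_dist 0 x \<le> hyp_length (linepath 0 x)"
    unfolding hyp_dist_def
  proof (rule cInf_lower)
    show "bdd_below {hyp_length p |p. p C1_differentiable_on {0..1} \<and> p ` {0..1} \<subseteq> hyp_space \<and> p 0 = 0 \<and> p 1 = x}"
    proof (rule bdd_belowI)
      fix l assume "l \<in> {hyp_length p |p. p C1_differentiable_on {0..1} \<and> p ` {0..1} \<subseteq> hyp_space \<and> p 0 = 0 \<and> p 1 = x}"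
      then obtain p where p: "l = hyp_length p" "p C1_differentiable_on {0..1}" "p ` {0..1} \<subseteq> hyp_space"
        "p 0 = 0" "p 1 = x"
        by blast
      show "busemann v 0 - busemann v x \<le> l"
        using busemann_le_hyp_length[OF v p(2,3)] p(1,4,5) by simp
    qed
  qed (use linepath_C1_in_hyp_space[OF _ x, of 0] in \<open>auto simp: linepath_def\<close>)
  also have "hyp_length (linepath 0 x) = integral {0..1} (\<lambda>t. 2 / (1 - (t * b)\<^sup>2) * b)"
    unfolding hyp_length_def
    by (intro integral_cong)
       (auto simp: vector_derivative_at[OF has_vector_derivative_linepath_within] linepath_def b_def)
  also have "\<dots> = (ln (1 + 1 * b) - ln (1 - 1 * b)) - (ln (1 + 0 * b) - ln (1 - 0 * b))"
  proof (intro integral_unique fundamental_theorem_of_calculus)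
    fix t :: real assume t: "t \<in> {0..1}"
    have "t * b \<le> 1 * b"
      using t b by (intro mult_right_mono) auto
    then have tb: "0 \<le> t * b" "t * b < 1"
      using t b by auto
    then have "(t * b)\<^sup>2 < 1"
      by (simp add: power_less_one_iff)
    then have "((\<lambda>t. ln (1 + t * b) - ln (1 - t * b)) has_real_derivative 2 / (1 - (t * b)\<^sup>2) * b) (at t within {0..1})"
      using tb
      by (auto intro!: derivative_eq_intros)
         (auto simp: divide_simps power2_eq_square, auto simp: algebra_simps)
    then show "((\<lambda>t. ln (1 + t * b) - ln (1 - t * b)) has_vector_derivative 2 / (1 - (t * b)\<^sup>2) * b) (at t within {0..1})"
      by (simp add: has_real_derivative_iff_has_vector_derivative)
  qed simp
  also have "\<dots> = 2 * artanh (norm x)"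
    using b unfolding b_def[symmetric] by (simp add: artanh_def ln_div)
  finally show ?thesis .
qed

text \<open>The distance from the centre fixes \<open>norm (c s) = tanh (s / 2)\<close>. For the direction, let \<open>v\<close> be
  the direction of the end point. The Busemann bound between \<open>c s\<close> and \<open>c h\<close>, whose distance is
  \<open>h - s\<close>, yields \<open>norm (v - c s) \<le> 1 - norm (c s)\<close>. This is equality in the triangle inequality
  \<open>norm v \<le> norm (c s) + norm (v - c s)\<close>, so \<open>c s\<close> is a nonnegative multiple of \<open>v\<close>.\<close>

lemma geodesic_segment_from_origin:
  fixes L :: "'a::euclidean_space set"
  assumes h: "0 \<le> h" and L: "geodesic_segment_from 0 h L"
  obtains v where "norm v = 1" and "L = (\<lambda>t. t *\<^sub>R v) ` {0..tanh (h / 2)}"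
proof -
  obtain c where c0: "c 0 = 0" and cL: "c ` {0..h} = L" and Lb: "L \<subseteq> hyp_space"
    and isometric: "\<forall>s\<in>{0..h}. \<forall>t\<in>{0..h}. hyp_dist (c s) (c t) = \<bar>s - t\<bar>"
    using L unfolding geodesic_segment_from_def by (elim exE conjE) (rule that)
  have iso: "hyp_dist (c s) (c t) = \<bar>s - t\<bar>" if "s \<in> {0..h}" "t \<in> {0..h}" for s t
    using isometric that by (elim ballE) auto
  have cb: "c s \<in> hyp_space" if "s \<in> {0..h}" for s
    using cL Lb that by blast
  have bus: "busemann u 0 = 0" if "norm u = 1" for u :: 'a
    using that by (simp add: busemann_def)
  have bus_ray: "busemann u (t *\<^sub>R u) = - 2 * artanh t" if "norm u = 1" "0 \<le> t" "t < 1" for u :: 'a and t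
  proof -
    have "u - t *\<^sub>R u = (1 - t) *\<^sub>R u"
      by (simp add: algebra_simps)
    then have "busemann u (t *\<^sub>R u) = ln ((1 - t)\<^sup>2 / (1 - t\<^sup>2))"
      using that by (simp add: busemann_def)
    also have "(1 - t)\<^sup>2 / (1 - t\<^sup>2) = (1 - t) / (1 + t)"
      using that mult_strict_mono[of t 1 t 1] by (simp add: divide_simps power2_eq_square) (auto simp: algebra_simps)
    also have "ln \<dots> = - 2 * artanh t"
      using that by (simp add: artanh_def ln_div)
    finally show ?thesis .
  qed
  have norm_c: "2 * artanh (norm (c s)) = s" if s: "s \<in> {0..h}" for s
  proof (rule antisym)
    obtain u :: 'a where u: "norm u = 1" "c s = norm (c s) *\<^sub>R u"
      by (rule unit_vector_along)
    have "2 * artanh (norm (c s)) = busemann u 0 - busemann u (c s)"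
      using bus[OF u(1)] bus_ray[OF u(1), of "norm (c s)"] u(2) cb[OF s] by simp
    also have "\<dots> \<le> hyp_dist (c 0) (c s)"
      using busemann_le_hyp_dist[OF u(1) _ cb[OF s], of 0] c0 by simp
    also have "\<dots> = s"
      using iso[of 0 s] s h by simp
    finally show "2 * artanh (norm (c s)) \<le> s" .
    have "s = hyp_dist 0 (c s)"
      using iso[of 0 s] s h c0 by simp
    also have "\<dots> \<le> 2 * artanh (norm (c s))"
      by (rule hyp_dist_origin_le[OF cb[OF s]])
    finally show "s \<le> 2 * artanh (norm (c s))" .
  qed
  have tanh_artanh: "tanh (artanh t) = t" if "0 \<le> t" "t < 1" for t :: real
  proof -
    have "artanh t = ln (sqrt ((1 + t) / (1 - t)))"
      using that by (simp add: artanh_def ln_sqrt)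
    then show ?thesis
      using that by (simp add: tanh_ln_real divide_simps)
  qed
  have norm_c': "norm (c s) = tanh (s / 2)" if "s \<in> {0..h}" for s
  proof -
    have "artanh (norm (c s)) = s / 2"
      using norm_c[OF that] by simp
    with tanh_artanh[of "norm (c s)"] cb[OF that] show ?thesis by simp
  qed
  obtain v :: 'a where v: "norm v = 1" "c h = norm (c h) *\<^sub>R v"
    by (rule unit_vector_along)
  have hh: "h \<in> {0..h}"
    using h by simp
  have ray: "c s = tanh (s / 2) *\<^sub>R v" if s: "s \<in> {0..h}" for s
  proof -
    have ns: "norm (c s) < 1"
      using cb[OF s] by simp
    then have sq: "(norm (c s))\<^sup>2 < 1"
      by (simp add: power_less_one_iff)
    have "busemann v (c s) + h \<le> h - s"
      using busemann_le_hyp_dist[OF v(1) cb[OF s] cb[OF hh]] bus_ray[OF v(1), of "norm (c h)"]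
        v(2) cb[OF hh] norm_c[OF hh] iso[OF s hh] s by simp
    then have "busemann v (c s) \<le> - 2 * artanh (norm (c s))"
      using norm_c[OF s] by simp
    also have "\<dots> = ln ((1 - norm (c s)) / (1 + norm (c s)))"
      using ns norm_ge_zero[of "c s"] by (simp add: artanh_def ln_div del: norm_ge_zero)
    finally have "(norm (v - c s))\<^sup>2 / (1 - (norm (c s))\<^sup>2) \<le> (1 - norm (c s)) / (1 + norm (c s))"
      unfolding busemann_def using ns v(1) sq
      by (subst (asm) ln_le_cancel_iff) (auto intro!: divide_pos_pos add_pos_nonneg)
    also have "\<dots> = (1 - norm (c s))\<^sup>2 / (1 - (norm (c s))\<^sup>2)"
    proof -
      have "1 + norm (c s) > 0" "1 - (norm (c s))\<^sup>2 = (1 - norm (c s)) * (1 + norm (c s))"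
        by (auto simp: add_pos_nonneg power2_eq_square algebra_simps)
      then show ?thesis
        using ns by (simp add: power2_eq_square)
    qed
    finally have "(norm (v - c s))\<^sup>2 \<le> (1 - norm (c s))\<^sup>2"
      using sq by (simp add: divide_le_cancel)
    then have "norm (v - c s) \<le> 1 - norm (c s)"
      using ns by (simp add: power2_le_iff_abs_le)
    then have "norm (c s + (v - c s)) = norm (c s) + norm (v - c s)"
      using norm_triangle_ineq[of "c s" "v - c s"] v(1) by simp
    \<comment> \<open>equality in the triangle inequality\<close>
    then have eq: "norm (c s) *\<^sub>R (v - c s) = norm (v - c s) *\<^sub>R c s"
      using norm_triangle_eq by blast
    have "norm (v - c s) = 1 - norm (c s)"
      using \<open>norm (v - c s) \<le> 1 - norm (c s)\<close> norm_triangle_ineq[of "c s" "v - c s"] v(1) by simp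
    with eq have "norm (c s) *\<^sub>R v = c s"
      by (simp add: algebra_simps)
    then show ?thesis
      using norm_c'[OF s] by simp
  qed
  have "L = (\<lambda>t. t *\<^sub>R v) ` ((\<lambda>s. tanh (s / 2)) ` {0..h})"
    unfolding cL[symmetric] image_image using ray by (intro image_cong) auto
  also have "(\<lambda>s. tanh (s / 2)) ` {0..h} = {0..tanh (h / 2)}"
  proof (intro equalityI subsetI)
    fix t assume t: "t \<in> {0..tanh (h / 2)}"
    then have "t < 1"
      using tanh_real_lt_1[of "h / 2"] by auto
    then have tt: "tanh (2 * artanh t / 2) = t"
      using tanh_artanh[of t] t by simp
    then have "tanh 0 \<le> tanh (artanh t)" "tanh (artanh t) \<le> tanh (h / 2)"
      using t by simp_all
    then have "2 * artanh t \<in> {0..h}"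
      unfolding tanh_real_le_iff by simp
    with tt show "t \<in> (\<lambda>s. tanh (s / 2)) ` {0..h}"
      by (intro image_eqI[of _ _ "2 * artanh t"]) auto
  qed auto
  finally show ?thesis
    using that[OF v(1)] by blast
qed

section \<open>Rotation invariance of Lebesgue measure\<close>

text \<open>Haar measure is unique. By Fubini, integrating \<open>indicator U x * indicator B (x + y)\<close> against
  the product of the two measures, and using the invariance of one measure or of the other, shows
  that the two values at \<open>B\<close> are proportional, with a factor that depends on \<open>U\<close> only. The
  symmetry of the ball \<open>U\<close> under negation is what returns the factor to a measure of \<open>U\<close>.\<close>

lemma lborel_unique_translation_invariant:
  fixes M :: "'a::euclidean_space measure"
  assumes "sigma_finite_measure M" and sets_M [measurable_cong]: "sets M = sets borel"
    and invariant: "\<And>c. distr M borel ((+) c) = M"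
    and unit_ball: "emeasure M (ball 0 1) = emeasure lborel (ball (0::'a) 1)"
  shows "M = lborel"
proof (rule measure_eqI)
  fix B :: "'a set" assume "B \<in> sets M"
  then have B [measurable]: "B \<in> sets borel"
    by (simp add: sets_M)
  interpret M: sigma_finite_measure M by fact
  interpret pair_sigma_finite M "lborel :: 'a measure" ..
  have shift_M: "(\<integral>\<^sup>+ y. g (c + y) \<partial>M) = (\<integral>\<^sup>+ y. g y \<partial>M)"
    if [measurable]: "g \<in> borel_measurable borel" for g and c :: 'a
    by (subst (2) invariant[of c, symmetric]) (simp add: nn_integral_distr)
  have shift: "(\<integral>\<^sup>+ y. g (c + y) \<partial>lborel) = (\<integral>\<^sup>+ y. g y \<partial>lborel)"
    if [measurable]: "g \<in> borel_measurable borel" for g and c :: 'a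
    by (subst (2) lborel_distr_plus[of c, symmetric]) (simp add: nn_integral_distr)
  define U where "U = ball (0::'a) 1"
  have U [measurable]: "U \<in> sets borel"
    by (simp add: U_def)
  have "emeasure lborel U * emeasure M B = (\<integral>\<^sup>+ x. (\<integral>\<^sup>+ y. indicator U x * indicator B y \<partial>M) \<partial>lborel)"
    by (simp add: nn_integral_cmult nn_integral_multc sets_M)
  also have "\<dots> = (\<integral>\<^sup>+ x. (\<integral>\<^sup>+ y. indicator U x * indicator B (x + y) \<partial>M) \<partial>lborel)"
  proof (rule nn_integral_cong)
    fix x :: 'a
    show "(\<integral>\<^sup>+ y. indicator U x * indicator B y \<partial>M) = (\<integral>\<^sup>+ y. indicator U x * indicator B (x + y) \<partial>M)"
      using shift_M[of "\<lambda>y. indicator U x * indicator B y" x] by simp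
  qed
  also have "\<dots> = (\<integral>\<^sup>+ y. (\<integral>\<^sup>+ x. indicator U x * indicator B (x + y) \<partial>lborel) \<partial>M)"
    by (rule Fubini') measurable
  also have "\<dots> = (\<integral>\<^sup>+ y. (\<integral>\<^sup>+ x. indicator U (x - y) * indicator B x \<partial>lborel) \<partial>M)"
  proof (rule nn_integral_cong)
    fix y :: 'a
    show "(\<integral>\<^sup>+ x. indicator U x * indicator B (x + y) \<partial>lborel) = (\<integral>\<^sup>+ x. indicator U (x - y) * indicator B x \<partial>lborel)"
      using shift[of "\<lambda>x. indicator U (x - y) * indicator B x" y] by (simp add: add.commute)
  qed
  also have "\<dots> = (\<integral>\<^sup>+ x. (\<integral>\<^sup>+ y. indicator U (x - y) * indicator B x \<partial>M) \<partial>lborel)"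
    by (rule Fubini'[symmetric]) measurable
  also have "\<dots> = (\<integral>\<^sup>+ x. indicator B x * emeasure M U \<partial>lborel)"
  proof (rule nn_integral_cong)
    fix x :: 'a
    have "(\<integral>\<^sup>+ y. indicator U (x - y) * indicator B x \<partial>M) = indicator B x * (\<integral>\<^sup>+ y. indicator U (x - y) \<partial>M)"
      by (subst mult.commute, rule nn_integral_cmult) measurable
    also have "(\<integral>\<^sup>+ y. indicator U (x - y) \<partial>M) = (\<integral>\<^sup>+ y. indicator U (- y) \<partial>M)"
      using shift_M[of "\<lambda>y. indicator U (x - y)" x] by simp
    also have "\<dots> = emeasure M U"
    proof -
      have "indicator U (- y) = (indicator U y :: ennreal)" for y
        by (simp add: U_def indicator_def)
      then show ?thesis
        using U sets_M by simp
    qed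
    finally show "(\<integral>\<^sup>+ y. indicator U (x - y) * indicator B x \<partial>M) = indicator B x * emeasure M U" .
  qed
  also have "\<dots> = emeasure lborel U * emeasure lborel B"
    by (simp add: nn_integral_multc U_def unit_ball mult.commute)
  finally have "emeasure lborel U * emeasure M B = emeasure lborel U * emeasure lborel B" .
  moreover have "emeasure lborel U \<noteq> 0" "emeasure lborel U \<noteq> \<infinity>"
    using unit_ball_vol_pos[of "real DIM('a)"] by (auto simp: U_def emeasure_ball simp del: unit_ball_vol_pos)
  ultimately show "emeasure M B = emeasure lborel B"
    by (simp add: ennreal_mult_cancel_left)
qed (simp add: sets_M)

text \<open>The reflection in the hyperplane orthogonal to \<open>w\<close>; for \<open>w = 0\<close> it is the identity, because
  division by zero yields zero. Reflections suffice to move any unit vector to any other.\<close>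

definition reflect :: "'a::euclidean_space \<Rightarrow> 'a \<Rightarrow> 'a" where
  "reflect w x = x - (2 * (x \<bullet> w) / (w \<bullet> w)) *\<^sub>R w"

lemma reflect_measurable [measurable]: "reflect w \<in> borel_measurable borel"
  unfolding reflect_def by measurable

lemma reflect_add: "reflect w (x + y) = reflect w x + reflect w y"
  by (simp add: reflect_def inner_add_left algebra_simps add_divide_distrib)

lemma reflect_reflect: "reflect w (reflect w x) = x"
  by (cases "w = 0") (simp_all add: reflect_def inner_diff_left algebra_simps)

lemma inner_reflect: "reflect w x \<bullet> reflect w y = x \<bullet> y"
  by (cases "w = 0")
     (simp_all add: reflect_def inner_diff_left inner_diff_right inner_commute algebra_simps)

lemma norm_reflect: "norm (reflect w x) = norm x"
  by (simp add: norm_eq_sqrt_inner inner_reflect)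

lemma reflect_swap:
  assumes "norm v = norm b"
  shows "reflect (v - b) v = b"
proof (cases "v = b")
  case False
  have "v \<bullet> v = b \<bullet> b"
    using assms by (simp add: norm_eq_sqrt_inner)
  then have eq: "2 * (v \<bullet> (v - b)) = (v - b) \<bullet> (v - b)"
    by (simp add: inner_diff_left inner_diff_right inner_commute)
  have nz: "(v - b) \<bullet> (v - b) \<noteq> 0"
    using False by simp
  show ?thesis
    unfolding reflect_def eq divide_self[OF nz] by simp
qed (simp add: reflect_def)

text \<open>A linear involution carries translations to translations, so the image measure is translation
  invariant; as an isometry it preserves the unit ball, which fixes the normalisation.\<close>

lemma lborel_distr_reflect: "distr lborel borel (reflect w) = (lborel :: 'a::euclidean_space measure)"
proof (rule lborel_unique_translation_invariant)
  fix c :: 'a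
  have "distr (distr lborel borel (reflect w)) borel ((+) c) = distr lborel borel (\<lambda>x. c + reflect w x)"
    by (subst distr_distr) (auto simp: comp_def)
  \<comment> \<open>the translation by \<open>c\<close> is moved to the other side of the involution\<close>
  also have "(\<lambda>x. c + reflect w x) = reflect w \<circ> (+) (reflect w c)"
    by (simp add: fun_eq_iff reflect_add reflect_reflect)
  also have "distr lborel borel \<dots> = distr (distr lborel borel ((+) (reflect w c))) borel (reflect w)"
    by (subst distr_distr) auto
  also have "\<dots> = distr lborel borel (reflect w)"
    by (simp add: lborel_distr_plus)
  finally show "distr (distr lborel borel (reflect w)) borel ((+) c) = distr lborel borel (reflect w)" .
next
  show "emeasure (distr lborel borel (reflect w)) (ball 0 1) = emeasure lborel (ball (0::'a) 1)"
  proof -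
    have "reflect w -` ball 0 1 = ball (0::'a) 1"
      by (auto simp: norm_reflect)
    then show ?thesis
      by (simp add: emeasure_distr)
  qed
next
  show "sigma_finite_measure (distr lborel borel (reflect w) :: 'a measure)"
  proof (standard, intro exI[of _ "range (\<lambda>n. ball 0 (real n))"] conjI ballI)
    show "\<Union> (range (\<lambda>n. ball 0 (real n))) = space (distr lborel borel (reflect w) :: 'a measure)"
      using reals_Archimedean2 by auto
  next
    fix A :: "'a set" assume "A \<in> range (\<lambda>n. ball 0 (real n))"
    then obtain n where A: "A = ball 0 (real n)"
      by blast
    have "reflect w -` A = A"
      by (auto simp: A norm_reflect)
    then show "emeasure (distr lborel borel (reflect w)) A \<noteq> \<infinity>"
      by (simp add: emeasure_distr A emeasure_ball)
  qed auto
qed simp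


lemma measure_halfspace_cone_rotate:
  fixes v b :: "'a::euclidean_space"
  assumes "norm v = 1" and "norm b = 1"
  shows "emeasure lborel {x \<in> cball 0 1. 0 < x \<bullet> v \<and> m * norm x \<le> x \<bullet> v}
       = emeasure lborel {x \<in> cball 0 1. 0 < x \<bullet> b \<and> m * norm x \<le> x \<bullet> b}"
proof -
  define w where "w = v - b"
  have "reflect w v = b"
    using assms by (simp add: w_def reflect_swap)
  then have "reflect w x \<bullet> b = x \<bullet> v" for x
    using inner_reflect[of w x v] by simp
  then have "reflect w -` {x \<in> cball 0 1. 0 < x \<bullet> b \<and> m * norm x \<le> x \<bullet> b}
      = {x \<in> cball 0 1. 0 < x \<bullet> v \<and> m * norm x \<le> x \<bullet> v}"
    by (auto simp: norm_reflect)
  then show ?thesis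
    by (subst (2) lborel_distr_reflect[of w, symmetric]) (simp add: emeasure_distr)
qed

section \<open>Spherical caps\<close>

text \<open>The volume of the cone over the spherical cap \<open>{u. m \<le> u \<bullet> v}\<close> in the unit ball of dimension
  \<open>n + 1\<close>: the first summand is the part at height at most \<open>m\<close> above the origin, a straight
  cone, and the second is the remaining piece of the ball.\<close>

definition cap_volume :: "nat \<Rightarrow> real \<Rightarrow> real" where
  "cap_volume n m = unit_ball_vol n *
     (m * sqrt (1 - m\<^sup>2) ^ n / (real n + 1) + integral {m..1} (\<lambda>s. sqrt (1 - s\<^sup>2) ^ n))"

text \<open>At height \<open>y\<close> the slice of the cone over a cap is an \<open>n\<close>-dimensional ball, bounded by the cone
  for \<open>y \<le> m\<close> and by the unit sphere for \<open>y \<ge> m\<close>.\<close>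

lemma has_integral_slice_volumes:
  assumes m: "0 < m" "m < 1"
  shows "((\<lambda>y. unit_ball_vol n * min (sqrt (1 - y\<^sup>2)) (y * sqrt (1 - m\<^sup>2) / m) ^ n) has_integral
           cap_volume n m) {0..1}"
proof -
  define w where "w = sqrt (1 - m\<^sup>2)"
  have m2: "m\<^sup>2 < 1"
    using m by (simp add: power_less_one_iff)
  have w: "w > 0" "w\<^sup>2 = 1 - m\<^sup>2"
    using m2 by (simp_all add: w_def)
  have min_eq: "min (sqrt (1 - y\<^sup>2)) (y * w / m) = (if y \<le> m then y * w / m else sqrt (1 - y\<^sup>2))"
    if y: "y \<in> {0..1}" for y
  proof -
    have y2: "y\<^sup>2 \<le> 1"
      using y by (simp add: power_le_one_iff)
    have "y * w / m \<le> sqrt (1 - y\<^sup>2) \<longleftrightarrow> (y * w / m)\<^sup>2 \<le> 1 - y\<^sup>2"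
      using y w m real_sqrt_le_iff[of "(y * w / m)\<^sup>2" "1 - y\<^sup>2"] by simp
    also have "\<dots> \<longleftrightarrow> y\<^sup>2 * (1 - m\<^sup>2) \<le> (1 - y\<^sup>2) * m\<^sup>2"
      using m by (simp add: power_mult_distrib power_divide w(2) divide_le_eq)
    also have "\<dots> \<longleftrightarrow> y\<^sup>2 \<le> m\<^sup>2"
      by (simp add: algebra_simps)
    also have "\<dots> \<longleftrightarrow> y \<le> m"
      using y m by (simp add: power2_le_iff_abs_le)
    finally show ?thesis by (auto simp: min_def)
  qed
  have "((\<lambda>y. (y * w / m) ^ n) has_integral
      (w / m) ^ n * m ^ Suc n / (real n + 1) - (w / m) ^ n * 0 ^ Suc n / (real n + 1)) {0..m}"
  proof (rule fundamental_theorem_of_calculus)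
    fix y :: real
    have "((\<lambda>y. (w / m) ^ n * y ^ Suc n / (real n + 1)) has_real_derivative
        (w / m) ^ n * ((1 + real n) * y ^ n) / (real n + 1)) (at y within {0..m})"
      using DERIV_pow[of "Suc n" y "{0..m}"]
      by (intro DERIV_cdivide DERIV_cmult) (simp add: add.commute)
    also have "(w / m) ^ n * ((1 + real n) * y ^ n) / (real n + 1) = (w / m) ^ n * y ^ n"
      by (simp add: divide_eq_eq add.commute)
    also have "\<dots> = (y * w / m) ^ n"
      by (simp add: power_mult_distrib power_divide)
    finally show "((\<lambda>y. (w / m) ^ n * y ^ Suc n / (real n + 1)) has_vector_derivative (y * w / m) ^ n) (at y within {0..m})"
      by (simp add: has_real_derivative_iff_has_vector_derivative)
  qed (use m in simp)
  then have low: "((\<lambda>y. (y * w / m) ^ n) has_integral m * w ^ n / (real n + 1)) {0..m}"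
    using m by (simp add: power_divide mult.commute[of m])
  then have low': "((\<lambda>y. min (sqrt (1 - y\<^sup>2)) (y * w / m) ^ n) has_integral m * w ^ n / (real n + 1)) {0..m}"
    by (rule has_integral_eq[rotated]) (use m min_eq in auto)
  have "((\<lambda>y. sqrt (1 - y\<^sup>2) ^ n) has_integral integral {m..1} (\<lambda>s. sqrt (1 - s\<^sup>2) ^ n)) {m..1}"
    by (intro integrable_integral integrable_continuous_interval continuous_intros)
  then have "((\<lambda>y. min (sqrt (1 - y\<^sup>2)) (y * w / m) ^ n) has_integral integral {m..1} (\<lambda>s. sqrt (1 - s\<^sup>2) ^ n)) {m..1}"
  proof (rule has_integral_eq[rotated])
    fix y assume "y \<in> {m..1}"
    then show "sqrt (1 - y\<^sup>2) ^ n = min (sqrt (1 - y\<^sup>2)) (y * w / m) ^ n"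
      using m by (subst min_eq) (auto simp: w_def)
  qed
  from has_integral_combine[OF _ _ low' this] m show ?thesis
    unfolding cap_volume_def w_def[symmetric] by (intro has_integral_mult_right) auto
qed

text \<open>Slicing orthogonally to a basis vector, where Lebesgue measure splits as a product.\<close>

lemma volume_cone_over_cap:
  fixes b :: "'a::euclidean_space"
  assumes b: "b \<in> Basis" and m: "0 < m" "m < 1" and n: "DIM('a) = Suc n"
  shows "emeasure lborel {x::'a \<in> cball 0 1. 0 < x \<bullet> b \<and> m * norm x \<le> x \<bullet> b} = cap_volume n m"
proof -
  interpret product_sigma_finite "\<lambda>_. lborel :: real measure"
    by standard
  define I where "I = (Basis :: 'a set) - {b}"
  have I: "finite I" "b \<notin> I" "insert b I = Basis" "card I = n"
    using b n by (auto simp: I_def)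
  define A where "A = {x::'a \<in> cball 0 1. 0 < x \<bullet> b \<and> m * norm x \<le> x \<bullet> b}"
  have A [measurable]: "A \<in> sets borel"
    unfolding A_def by measurable
  define R where "R y = min (sqrt (1 - y\<^sup>2)) (y * sqrt (1 - m\<^sup>2) / m)" for y
  define S where "S y = {f. sqrt (\<Sum>i\<in>I. (f i)\<^sup>2) \<le> R y} \<inter> space (\<Pi>\<^sub>M i\<in>I. lborel)" for y
  have m2: "m\<^sup>2 < 1"
    using m by (simp add: power_less_one_iff)
  have slice: "indicator A (\<Sum>i\<in>Basis. (f(b := y)) i *\<^sub>R i) = (indicator {0<..1} y * indicator (S y) f :: ennreal)"
    if f: "f \<in> space (\<Pi>\<^sub>M i\<in>I. lborel)" for f :: "'a \<Rightarrow> real" and y :: real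
  proof -
    define x where "x = (\<Sum>i\<in>Basis. (f(b := y)) i *\<^sub>R i)"
    define q where "q = (\<Sum>i\<in>I. (f i)\<^sup>2)"
    have q: "q \<ge> 0"
      by (simp add: q_def sum_nonneg)
    have xi: "x \<bullet> i = (f(b := y)) i" if "i \<in> Basis" for i
      using that by (simp add: x_def)
    have "(norm x)\<^sup>2 = (\<Sum>i\<in>Basis. ((f(b := y)) i)\<^sup>2)"
      unfolding power2_norm_eq_inner euclidean_inner[of x x]
      by (intro sum.cong) (simp_all add: xi power2_eq_square)
    also have "\<dots> = y\<^sup>2 + q"
      unfolding I(3)[symmetric] q_def using I(1,2)
      by (subst sum.insert) (auto intro!: sum.cong)
    finally have nx: "(norm x)\<^sup>2 = y\<^sup>2 + q" .
    have "x \<in> A \<longleftrightarrow> norm x \<le> 1 \<and> 0 < y \<and> m * norm x \<le> y"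
      by (simp add: A_def xi b)
    also have "\<dots> \<longleftrightarrow> (norm x)\<^sup>2 \<le> 1 \<and> 0 < y \<and> (m * norm x)\<^sup>2 \<le> y\<^sup>2"
      using m abs_le_square_iff[of "norm x" 1] abs_le_square_iff[of "m * norm x" y]
      by (auto simp: abs_mult)
    also have "\<dots> \<longleftrightarrow> 0 < y \<and> y \<le> 1 \<and> q \<le> 1 - y\<^sup>2 \<and> q \<le> (y * sqrt (1 - m\<^sup>2) / m)\<^sup>2"
    proof -
      have "q \<le> (y * sqrt (1 - m\<^sup>2) / m)\<^sup>2 \<longleftrightarrow> (m * norm x)\<^sup>2 \<le> y\<^sup>2"
        using m m2 by (simp add: power_mult_distrib power_divide nx le_divide_eq algebra_simps)
      moreover have "y \<le> 1" if "0 < y" "y\<^sup>2 + q \<le> 1"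
      proof -
        have "y\<^sup>2 \<le> 1"
          using that q by simp
        then show ?thesis
          using that(1) abs_le_square_iff[of y 1] by simp
      qed
      ultimately show ?thesis
        by (auto simp: nx)
    qed
    also have "\<dots> \<longleftrightarrow> y \<in> {0<..1} \<and> f \<in> S y"
    proof -
      have "sqrt q \<le> y * sqrt (1 - m\<^sup>2) / m \<longleftrightarrow> q \<le> (y * sqrt (1 - m\<^sup>2) / m)\<^sup>2" if "0 < y"
        using that m m2 by (intro real_sqrt_le_iff' q) auto
      then show ?thesis
        using f by (auto simp: S_def R_def q_def)
    qed
    finally show ?thesis
      by (simp add: x_def indicator_def)
  qed
  have S_meas: "S y \<in> sets (\<Pi>\<^sub>M i\<in>I. lborel)" for y
    unfolding S_def using I(1) by measurable
  have "emeasure lborel A = (\<integral>\<^sup>+ x. indicator A x \<partial>lborel)"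
    by simp
  also have "\<dots> = (\<integral>\<^sup>+ f. indicator A (\<Sum>i\<in>Basis. f i *\<^sub>R i) \<partial>(\<Pi>\<^sub>M i\<in>Basis. lborel))"
    by (subst lborel_eq, subst nn_integral_distr) simp_all
  also have "\<dots> = (\<integral>\<^sup>+ y. \<integral>\<^sup>+ f. indicator A (\<Sum>i\<in>Basis. (f(b := y)) i *\<^sub>R i) \<partial>(\<Pi>\<^sub>M i\<in>I. lborel) \<partial>lborel)"
    by (subst (1) I(3)[symmetric], rule product_nn_integral_insert_rev) (use I in simp_all)
  also have "\<dots> = (\<integral>\<^sup>+ y. indicator {0<..1} y * emeasure (\<Pi>\<^sub>M i\<in>I. lborel) (S y) \<partial>lborel)"
  proof (rule nn_integral_cong)
    fix y :: real
    have "(\<integral>\<^sup>+ f. indicator A (\<Sum>i\<in>Basis. (f(b := y)) i *\<^sub>R i) \<partial>(\<Pi>\<^sub>M i\<in>I. lborel))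
        = (\<integral>\<^sup>+ f. indicator {0<..1} y * indicator (S y) f \<partial>(\<Pi>\<^sub>M i\<in>I. lborel))"
      by (rule nn_integral_cong) (rule slice)
    also have "\<dots> = indicator {0<..1} y * emeasure (\<Pi>\<^sub>M i\<in>I. lborel) (S y)"
      using S_meas[of y] by (subst nn_integral_cmult) auto
    finally show "(\<integral>\<^sup>+ f. indicator A (\<Sum>i\<in>Basis. (f(b := y)) i *\<^sub>R i) \<partial>(\<Pi>\<^sub>M i\<in>I. lborel))
        = indicator {0<..1} y * emeasure (\<Pi>\<^sub>M i\<in>I. lborel) (S y)" .
  qed
  also have "\<dots> = (\<integral>\<^sup>+ y. indicator {0..1} y * ennreal (unit_ball_vol n * R y ^ n) \<partial>lborel)"
  proof (rule nn_integral_cong_AE)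
    \<comment> \<open>the slice degenerates to a point at the two ends\<close>
    have "AE y in lborel. y \<notin> {0, 1::real}"
      by (intro AE_not_in countable_imp_null_set_lborel) auto
    then show "AE y in lborel. indicator {0<..1} y * emeasure (\<Pi>\<^sub>M i\<in>I. lborel) (S y)
        = indicator {0..1} y * ennreal (unit_ball_vol n * R y ^ n)"
    proof eventually_elim
      case (elim y)
      show ?case
      proof (cases "y \<in> {0<..<1}")
        case True
        then have "y\<^sup>2 < 1"
          by (simp add: power_less_one_iff)
        then have "R y > 0"
          using True m m2 by (simp add: R_def)
        then show ?thesis
          using True emeasure_cball_aux[OF I(1), of "R y"] I(4) by (simp add: S_def)
      qed (use elim in \<open>auto simp: indicator_def\<close>)
    qed
  qed
  also have "\<dots> = (\<integral>\<^sup>+ y. ennreal (indicator {0..1} y * (unit_ball_vol n * R y ^ n)) \<partial>lborel)"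
    by (rule nn_integral_cong) (auto simp: indicator_def)
  also have "\<dots> = cap_volume n m"
  proof (rule nn_integral_has_integral_lebesgue)
    fix y :: real assume y: "y \<in> {0..1}"
    then have "y\<^sup>2 \<le> 1"
      by (simp add: power_le_one_iff)
    then show "0 \<le> unit_ball_vol n * R y ^ n"
      using y m m2 by (simp add: R_def)
  qed (use has_integral_slice_volumes[OF m, of n] in \<open>simp add: R_def\<close>)
  finally show ?thesis
    by (simp add: A_def)
qed

lemma sets_sphere_measure [measurable_cong]:
  "sets (sphere_measure :: 'a::euclidean_space measure) = sets (restrict_space borel (sphere 0 1))"
  by (simp add: sphere_measure_def sets_restrict_space)

lemma space_sphere_measure [simp]: "space (sphere_measure :: 'a::euclidean_space measure) = sphere 0 1"
  by (simp add: sphere_measure_def space_restrict_space)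

lemma emeasure_sphere_measure:
  assumes "B \<in> sets borel" and "B \<subseteq> sphere (0::'a::euclidean_space) 1"
  shows "emeasure sphere_measure B
           = emeasure lborel {x \<in> cball 0 1. sgn x \<in> B} / ennreal (unit_ball_vol DIM('a))"
proof -
  have [measurable]: "B \<in> sets borel" by fact
  have sgn_meas [measurable]: "sgn \<in> borel_measurable (borel :: 'a measure)"
    unfolding sgn_div_norm[abs_def] by measurable
  have "emeasure sphere_measure B = emeasure (uniform_measure lborel (ball 0 1)) (sgn -` B)"
    unfolding sphere_measure_def using assms
    by (subst emeasure_restrict_space) (auto simp: emeasure_distr)
  also have "\<dots> = emeasure lborel (ball 0 1 \<inter> sgn -` B) / ennreal (unit_ball_vol DIM('a))"
    using measurable_sets[OF sgn_meas assms(1)]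
    by (subst emeasure_uniform_measure) (auto simp: emeasure_ball)
  also have "emeasure lborel (ball 0 1 \<inter> sgn -` B) = emeasure lborel {x \<in> cball 0 1. sgn x \<in> B}"
  proof (rule emeasure_eq_AE)
    have "sphere (0::'a) 1 \<in> null_sets lborel"
      using negligible_sphere[of 0 1]
      by (auto simp: null_sets_completion_iff negligible_iff_null_sets negligible_convex_frontier)
    then have "AE x in lborel. x \<notin> sphere (0::'a) 1"
      by (rule AE_not_in)
    then show "AE x in lborel. x \<in> ball 0 1 \<inter> sgn -` B \<longleftrightarrow> x \<in> {x \<in> cball 0 1. sgn x \<in> B}"
      by eventually_elim auto
  next
    have "sgn -` B \<in> sets borel"
      using measurable_sets[OF sgn_meas assms(1)] by simp
    then have "ball 0 1 \<inter> sgn -` B \<in> sets borel" "cball 0 1 \<inter> sgn -` B \<in> sets borel"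
      by auto
    moreover have "{x \<in> cball 0 1. sgn x \<in> B} = cball 0 1 \<inter> sgn -` B"
      by auto
    ultimately show "ball 0 1 \<inter> sgn -` B \<in> sets lborel" "{x \<in> cball 0 1. sgn x \<in> B} \<in> sets lborel"
      by simp_all
  qed
  finally show ?thesis .
qed

text \<open>A reflection reduces the cap around \<open>v\<close> to the cap around a basis vector.\<close>

lemma emeasure_sphere_cap:
  fixes v :: "'a::euclidean_space"
  assumes v: "norm v = 1" and m: "0 < m" "m < 1" and n: "DIM('a) = Suc n"
  shows "emeasure sphere_measure {u \<in> sphere 0 1. m \<le> u \<bullet> v} = ennreal (cap_volume n m / unit_ball_vol (Suc n))"
proof -
  have "sgn x \<in> {u \<in> sphere 0 1. m \<le> u \<bullet> v} \<longleftrightarrow> 0 < x \<bullet> v \<and> m * norm x \<le> x \<bullet> v" for x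
  proof (cases "x = 0")
    case False
    then have "sgn x \<in> {u \<in> sphere 0 1. m \<le> u \<bullet> v} \<longleftrightarrow> m * norm x \<le> x \<bullet> v"
      by (simp add: norm_sgn sgn_div_norm field_simps)
    moreover have "0 < m * norm x"
      using False m by simp
    ultimately show ?thesis by linarith
  qed simp
  moreover have "{u \<in> sphere 0 1. m \<le> u \<bullet> v} \<in> sets borel"
    by measurable
  ultimately have "emeasure sphere_measure {u \<in> sphere 0 1. m \<le> u \<bullet> v}
      = emeasure lborel {x \<in> cball 0 1. 0 < x \<bullet> v \<and> m * norm x \<le> x \<bullet> v} / ennreal (unit_ball_vol DIM('a))"
    by (subst emeasure_sphere_measure) auto
  also have "emeasure lborel {x \<in> cball 0 1. 0 < x \<bullet> v \<and> m * norm x \<le> x \<bullet> v} = ennreal (cap_volume n m)"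
    by (subst measure_halfspace_cone_rotate[OF v, of "SOME i. i \<in> Basis"])
       (use volume_cone_over_cap[OF SOME_Basis m n] in \<open>auto simp: SOME_Basis\<close>)
  also have "ennreal (cap_volume n m) / ennreal (unit_ball_vol DIM('a)) = ennreal (cap_volume n m / unit_ball_vol (Suc n))"
    unfolding n by (rule divide_ennreal) (use m in \<open>auto simp: cap_volume_def power_le_one_iff
        intro!: mult_nonneg_nonneg add_nonneg_nonneg integral_nonneg integrable_continuous_interval continuous_intros\<close>)
  finally show ?thesis .
qed

lemma finite_measure_sphere_measure: "finite_measure (sphere_measure :: 'a::euclidean_space measure)"
proof (rule finite_measureI)
  have "emeasure lborel {x::'a \<in> cball 0 1. sgn x \<in> sphere 0 1} \<le> emeasure lborel (cball (0::'a) 1)"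
    by (rule emeasure_mono) auto
  also have "\<dots> < \<infinity>"
    by (simp add: emeasure_cball)
  finally show "emeasure sphere_measure (space sphere_measure :: 'a set) \<noteq> \<infinity>"
    using unit_ball_vol_pos[of "real DIM('a)"]
    by (simp add: emeasure_sphere_measure ennreal_divide_eq_top_iff del: unit_ball_vol_pos)
qed

section \<open>Hyperplanes meeting a radial segment\<close>

text \<open>The hyperplane with parameters \<open>(r, u)\<close> lies on the sphere with centre \<open>(r + R) u\<close> and radius
  \<open>R\<close>. The following three quantities describe the triangle formed by the origin, this centre and
  the point \<open>t v\<close> of the sphere: the quotient \<open>(r + R) / R\<close> of two of its sides, the cosine of
  the angle at the origin, and the cosine of the angle between \<open>v\<close> and the inward normal of the
  sphere at \<open>t v\<close>. The angle at the origin is determined by \<open>r\<close> and \<open>t\<close> through the law of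
  cosines.\<close>

definition centre_ratio :: "real \<Rightarrow> real \<Rightarrow> real" where
  "centre_ratio l r = (1 + 2 * l * r + r\<^sup>2) / (1 - r\<^sup>2)"

definition axis_cos :: "real \<Rightarrow> real \<Rightarrow> real \<Rightarrow> real" where
  "axis_cos l r t = (t\<^sup>2 * (l + r) + r * (1 + l * r)) / (t * (1 + 2 * l * r + r\<^sup>2))"

definition incidence_cos :: "real \<Rightarrow> real \<Rightarrow> real \<Rightarrow> real" where
  "incidence_cos l r t = (r * (1 + l * r) - t\<^sup>2 * (l + r)) / (t * (1 - r\<^sup>2))"

context
  fixes l r :: real
  assumes l: "0 \<le> l" and r: "0 \<le> r" "r < 1"
begin

lemma one_minus_r2_pos: "0 < 1 - r\<^sup>2"
  using r by (simp add: power_less_one_iff)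

lemma denominator_pos: "0 < 1 + 2 * l * r + r\<^sup>2"
  using l r by (intro add_pos_nonneg) auto

lemma centre_ratio_pos: "0 < centre_ratio l r"
  unfolding centre_ratio_def using one_minus_r2_pos denominator_pos by simp

text \<open>The law of sines for the triangle.\<close>

lemma one_minus_axis_cos_sq:
  assumes t: "0 < t"
  shows "1 - (axis_cos l r t)\<^sup>2 = (1 - (incidence_cos l r t)\<^sup>2) / (centre_ratio l r)\<^sup>2"
proof -
  define D E P Q where "D = 1 + 2 * l * r + r\<^sup>2" and "E = 1 - r\<^sup>2"
    and "P = t\<^sup>2 * (l + r)" and "Q = r * (1 + l * r)"
  have pos: "D > 0" "E > 0"
    using one_minus_r2_pos denominator_pos by (simp_all add: D_def E_def)
  have "D\<^sup>2 - E\<^sup>2 = 4 * (l + r) * Q"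
    by (simp add: D_def E_def Q_def power2_eq_square algebra_simps)
  \<comment> \<open>\<open>t\<^sup>2 * (D\<^sup>2 - E\<^sup>2)\<close> and \<open>(P + Q)\<^sup>2 - (Q - P)\<^sup>2\<close> are both \<open>4 * P * Q\<close>\<close>
  then have "t\<^sup>2 * D\<^sup>2 - (P + Q)\<^sup>2 = t\<^sup>2 * E\<^sup>2 - (Q - P)\<^sup>2"
    by (simp add: P_def power2_eq_square algebra_simps)
  then have "(t\<^sup>2 * D\<^sup>2 - (P + Q)\<^sup>2) / (t * D)\<^sup>2 = (t\<^sup>2 * E\<^sup>2 - (Q - P)\<^sup>2) / (t * D)\<^sup>2"
    by simp
  moreover have "(t\<^sup>2 * D\<^sup>2 - (P + Q)\<^sup>2) / (t * D)\<^sup>2 = 1 - ((P + Q) / (t * D))\<^sup>2"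
    using t pos by (simp add: diff_divide_distrib power_divide power_mult_distrib)
  moreover have "(t\<^sup>2 * E\<^sup>2 - N\<^sup>2) / (t * D)\<^sup>2 = (1 - (N / (t * E))\<^sup>2) / (D / E)\<^sup>2" for N
    using t pos by (simp add: diff_divide_distrib power_divide power_mult_distrib left_diff_distrib)
  ultimately show ?thesis
    unfolding axis_cos_def incidence_cos_def centre_ratio_def D_def E_def P_def Q_def by simp
qed

lemma axis_cos_has_derivative:
  assumes t: "0 < t"
  shows "(axis_cos l r has_real_derivative - incidence_cos l r t / (t * centre_ratio l r)) (at t)"
proof -
  define D E Q k where "D = 1 + 2 * l * r + r\<^sup>2" and "E = 1 - r\<^sup>2" and "Q = r * (1 + l * r)" and "k = l + r"
  have pos: "D > 0" "E > 0"
    using one_minus_r2_pos denominator_pos by (simp_all add: D_def E_def)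
  have "((\<lambda>t. (t\<^sup>2 * k + Q) / (t * D)) has_real_derivative
      ((2 * t * k) * (t * D) - (t\<^sup>2 * k + Q) * D) / ((t * D) * (t * D))) (at t)"
    using t pos by (auto intro!: derivative_eq_intros)
  also have "((2 * t * k) * (t * D) - (t\<^sup>2 * k + Q) * D) / ((t * D) * (t * D))
      = - ((Q - t\<^sup>2 * k) / (t * E)) / (t * (D / E))"
    using t pos by (simp add: field_simps power2_eq_square)
  finally show ?thesis
    unfolding axis_cos_def[abs_def] incidence_cos_def centre_ratio_def D_def E_def Q_def k_def .
qed

lemma incidence_cos_has_derivative:
  assumes t: "0 < t"
  shows "((\<lambda>r. incidence_cos l r t) has_real_derivative (1 - t\<^sup>2) * centre_ratio l r / (t * (1 - r\<^sup>2))) (at r)"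
proof -
  have E: "1 - r\<^sup>2 > 0"
    by (rule one_minus_r2_pos)
  have "((\<lambda>r. (r * (1 + l * r) - t\<^sup>2 * (l + r)) / (t * (1 - r\<^sup>2))) has_real_derivative
      ((1 + 2 * l * r - t\<^sup>2) * (t * (1 - r\<^sup>2)) - (r * (1 + l * r) - t\<^sup>2 * (l + r)) * (t * (- 2 * r)))
        / ((t * (1 - r\<^sup>2)) * (t * (1 - r\<^sup>2)))) (at r)"
    using t E by (auto intro!: derivative_eq_intros simp: algebra_simps)
  also have "(1 + 2 * l * r - t\<^sup>2) * (t * (1 - r\<^sup>2)) - (r * (1 + l * r) - t\<^sup>2 * (l + r)) * (t * (- 2 * r))
      = t * ((1 - t\<^sup>2) * (1 + 2 * l * r + r\<^sup>2))"
    by (simp add: power2_eq_square algebra_simps)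
  also have "t * ((1 - t\<^sup>2) * (1 + 2 * l * r + r\<^sup>2)) / ((t * (1 - r\<^sup>2)) * (t * (1 - r\<^sup>2)))
      = (1 - t\<^sup>2) * ((1 + 2 * l * r + r\<^sup>2) / (1 - r\<^sup>2)) / (t * (1 - r\<^sup>2))"
    using t E by simp
  finally show ?thesis
    unfolding incidence_cos_def centre_ratio_def .
qed

text \<open>The factorisation exhibits the sign: the incidence is orthogonal at \<open>t = r\<close>, where \<open>t v\<close> is the
  point of the hyperplane closest to the origin.\<close>

lemma one_minus_incidence_cos:
  assumes t: "0 < t"
  shows "1 - incidence_cos l r t = (t - r) * (1 + t * r + l * (t + r)) / (t * (1 - r\<^sup>2))"
proof -
  have "1 - incidence_cos l r t
      = (t * (1 - r\<^sup>2) - (r * (1 + l * r) - t\<^sup>2 * (l + r))) / (t * (1 - r\<^sup>2))"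
    unfolding incidence_cos_def diff_divide_distrib using t one_minus_r2_pos by simp
  also have "t * (1 - r\<^sup>2) - (r * (1 + l * r) - t\<^sup>2 * (l + r)) = (t - r) * (1 + t * r + l * (t + r))"
    by (simp add: power2_eq_square algebra_simps)
  finally show ?thesis .
qed

lemma incidence_cos_less_1: "r < t \<Longrightarrow> incidence_cos l r t < 1"
proof -
  assume t: "r < t"
  have "0 < 1 + t * r + l * (t + r)"
    using t r l by (intro add_pos_nonneg) auto
  then have "0 < 1 - incidence_cos l r t"
    using t r one_minus_r2_pos by (subst one_minus_incidence_cos) auto
  then show ?thesis by simp
qed

end

lemma incidence_cos_self:
  assumes "0 \<le> l" and "0 < r" "r < 1"
  shows "incidence_cos l r r = 1"
  using one_minus_incidence_cos[of l r r] assms by simp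

lemma axis_cos_pos:
  assumes "0 \<le> l" and "0 < r" "r < 1" and "0 < t"
  shows "0 < axis_cos l r t"
proof -
  have "0 < r * (1 + l * r)"
    using assms by (intro mult_pos_pos add_pos_nonneg) auto
  then have "0 < t\<^sup>2 * (l + r) + r * (1 + l * r)"
    using assms by (intro add_nonneg_pos mult_nonneg_nonneg) auto
  then show ?thesis
    unfolding axis_cos_def using assms denominator_pos[of l r] by simp
qed

lemma axis_cos_self:
  assumes "0 \<le> l" and "0 < r" "r < 1"
  shows "axis_cos l r r = 1"
proof -
  have "1 - (axis_cos l r r)\<^sup>2 = 0"
    using assms by (subst one_minus_axis_cos_sq) (auto simp: incidence_cos_self)
  then show ?thesis
    using axis_cos_pos[of l r r] assms by (simp add: power2_eq_1_iff)
qed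

lemma incidence_cos_nonneg_iff:
  assumes "0 \<le> l" and "0 < r" "r < 1" and "0 < t"
  shows "0 \<le> incidence_cos l r t \<longleftrightarrow> t \<le> sqrt (r * (1 + l * r) / (l + r))"
proof -
  have "0 \<le> incidence_cos l r t \<longleftrightarrow> t\<^sup>2 * (l + r) \<le> r * (1 + l * r)"
    unfolding incidence_cos_def using assms one_minus_r2_pos[of l r]
    by (subst pos_le_divide_eq) auto
  also have "\<dots> \<longleftrightarrow> t\<^sup>2 \<le> r * (1 + l * r) / (l + r)"
    using assms by (simp add: le_divide_eq)
  also have "\<dots> \<longleftrightarrow> sqrt (t\<^sup>2) \<le> sqrt (r * (1 + l * r) / (l + r))"
    by (rule real_sqrt_le_iff[symmetric])
  finally show ?thesis
    using assms by simp
qed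

text \<open>The equation of the sphere, multiplied by \<open>l + r\<close>, is linear in \<open>u \<bullet> v\<close>; at \<open>t = 0\<close> it fails,
  as the hyperplane does not contain the origin.\<close>

lemma ray_point_in_hyperplane_iff:
  fixes u v :: "'a::euclidean_space"
  assumes l: "0 \<le> l" and r: "0 < r" "r < 1" and u: "norm u = 1" and v: "norm v = 1"
    and t: "0 \<le> t" "t < 1"
  shows "t *\<^sub>R v \<in> hyperplane l r u \<longleftrightarrow> 0 < t \<and> u \<bullet> v = axis_cos l r t"
proof -
  define R where "R = (1 - r\<^sup>2) / (2 * (l + r))"
  define D where "D = 1 + 2 * l * r + r\<^sup>2"
  have D: "D > 0"
    using denominator_pos[of l r] l r by (simp add: D_def)
  have lr: "l + r > 0"
    using l r by simp
  have R: "R > 0"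
    using one_minus_r2_pos[of l r] l r by (simp add: R_def)
  have centre: "2 * (l + r) * (r + R) = D" and power_r: "(l + r) * (r\<^sup>2 + 2 * r * R) = r * (1 + l * r)"
    using lr by (simp_all add: R_def D_def field_simps power2_eq_square)
  have sq: "(norm (t *\<^sub>R v - (r + R) *\<^sub>R u))\<^sup>2 = t\<^sup>2 - 2 * t * (r + R) * (u \<bullet> v) + (r + R)\<^sup>2"
  proof -
    have "u \<bullet> u = 1" "v \<bullet> v = 1"
      using u v by (simp_all add: power2_norm_eq_inner[symmetric])
    then show ?thesis
      unfolding power2_norm_eq_inner
      by (simp add: inner_diff_left inner_diff_right inner_commute[of v u] power2_eq_square algebra_simps)
  qed
  have "t *\<^sub>R v \<in> hyperplane l r u \<longleftrightarrow> norm (t *\<^sub>R v - (r + R) *\<^sub>R u) = R"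
    using t v by (simp add: hyperplane_def R_def Let_def)
  also have "\<dots> \<longleftrightarrow> (norm (t *\<^sub>R v - (r + R) *\<^sub>R u))\<^sup>2 = R\<^sup>2"
    using R by (simp add: power2_eq_iff_nonneg)
  also have "\<dots> \<longleftrightarrow> t\<^sup>2 + (r\<^sup>2 + 2 * r * R) = 2 * t * (r + R) * (u \<bullet> v)"
    unfolding sq by (auto simp: power2_eq_square algebra_simps)
  also have "\<dots> \<longleftrightarrow> (l + r) * (t\<^sup>2 + (r\<^sup>2 + 2 * r * R)) = (l + r) * (2 * t * (r + R) * (u \<bullet> v))"
    using lr by simp
  also have "\<dots> \<longleftrightarrow> t\<^sup>2 * (l + r) + r * (1 + l * r) = t * D * (u \<bullet> v)"
  proof -
    have "(l + r) * (t\<^sup>2 + (r\<^sup>2 + 2 * r * R)) = t\<^sup>2 * (l + r) + r * (1 + l * r)"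
      by (subst distrib_left, subst power_r) (simp add: mult.commute)
    moreover have "(l + r) * (2 * t * (r + R) * (u \<bullet> v)) = t * D * (u \<bullet> v)"
      unfolding centre[symmetric] by (simp only: ac_simps)
    ultimately show ?thesis by (simp only:)
  qed
  also have "\<dots> \<longleftrightarrow> 0 < t \<and> u \<bullet> v = axis_cos l r t"
  proof (cases "t = 0")
    case True
    have "r * (1 + l * r) > 0"
      using l r by (intro mult_pos_pos add_pos_nonneg) auto
    with True show ?thesis by auto
  next
    case False
    with t D show ?thesis
      unfolding axis_cos_def D_def[symmetric] by (auto simp: field_simps)
  qed
  finally show ?thesis .
qed

text \<open>The parameter at which a ray tangent to a hyperplane of distance \<open>r\<close> touches it; for geodesic
  hyperplanes, \<open>l = 0\<close>, this happens only on the boundary, at 1. It separates the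
  points of entry into the convex side, at which \<open>incidence_cos\<close> is nonnegative, from the points
  of exit.\<close>

definition tangency_time :: "real \<Rightarrow> real \<Rightarrow> real" where
  "tangency_time l r = sqrt (r * (1 + l * r) / (l + r))"

lemma less_tangency_time:
  assumes "0 \<le> l" and "0 < r" "r < 1"
  shows "r < tangency_time l r"
proof -
  have "r\<^sup>2 < 1"
    using assms by (simp add: power_less_one_iff)
  then have "r * r < 1"
    by (simp add: power2_eq_square)
  then have "r * (l + r) < 1 + l * r"
    by (simp add: algebra_simps)
  then have "r * (r * (l + r)) < r * (1 + l * r)"
    using assms by (intro mult_strict_left_mono) auto
  then have "r\<^sup>2 < r * (1 + l * r) / (l + r)"
    using assms by (simp add: less_divide_eq power2_eq_square mult.assoc)
  then show ?thesis
    unfolding tangency_time_def using assms real_less_rsqrt by blast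
qed

lemma axis_cos_antimono:
  assumes "0 \<le> l" and "0 < r" "r < 1" and "0 < s" "s \<le> t" "t \<le> tangency_time l r"
  shows "axis_cos l r t \<le> axis_cos l r s"
proof (rule DERIV_nonpos_imp_nonincreasing[OF assms(5)])
  fix x assume x: "s \<le> x" "x \<le> t"
  then have "0 \<le> incidence_cos l r x"
    using assms by (subst incidence_cos_nonneg_iff) (auto simp: tangency_time_def)
  then have "- incidence_cos l r x / (x * centre_ratio l r) \<le> 0"
    using centre_ratio_pos[of l r] x assms by (simp add: zero_le_divide_iff)
  then show "\<exists>y. (axis_cos l r has_real_derivative y) (at x) \<and> y \<le> 0"
    using axis_cos_has_derivative[of l r x] x assms by auto
qed

lemma axis_cos_less_1:
  assumes l: "0 \<le> l" and r: "0 < r" "r < 1" and t: "r < t" "t \<le> tangency_time l r"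
  shows "axis_cos l r t < 1"
proof -
  have "0 \<le> incidence_cos l r t"
    using t r by (subst incidence_cos_nonneg_iff[OF l r]) (auto simp: tangency_time_def)
  then have "(incidence_cos l r t)\<^sup>2 < 1"
    using incidence_cos_less_1[of l r t] t l r by (simp add: power_less_one_iff)
  then have "0 < 1 - (axis_cos l r t)\<^sup>2"
    using centre_ratio_pos[of l r] t r l by (subst one_minus_axis_cos_sq) auto
  then show ?thesis
    using axis_cos_pos[of l r t] t r l by (simp add: power_less_one_iff)
qed

lemma axis_cos_mono:
  assumes "0 \<le> l" and "0 < r" "r < 1" and "tangency_time l r \<le> s" "s \<le> t"
  shows "axis_cos l r s \<le> axis_cos l r t"
proof (rule DERIV_nonneg_imp_nondecreasing[OF assms(5)])
  fix x assume x: "s \<le> x" "x \<le> t"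
  then have x0: "0 < x"
    using assms less_tangency_time[of l r] by linarith
  have "incidence_cos l r x \<le> 0"
  proof -
    have "incidence_cos l r x * (x * (1 - r\<^sup>2)) = r * (1 + l * r) - x\<^sup>2 * (l + r)"
      unfolding incidence_cos_def using x0 one_minus_r2_pos[of l r] assms by simp
    moreover have "r * (1 + l * r) / (l + r) \<le> x\<^sup>2"
      using x assms real_sqrt_le_iff[of "r * (1 + l * r) / (l + r)" "x\<^sup>2"] x0
      by (simp add: tangency_time_def)
    then have "r * (1 + l * r) \<le> x\<^sup>2 * (l + r)"
      using assms by (simp add: divide_le_eq)
    ultimately have "incidence_cos l r x * (x * (1 - r\<^sup>2)) \<le> 0"
      by simp
    then show ?thesis
      using x0 one_minus_r2_pos[of l r] assms by (simp add: mult_le_0_iff)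
  qed
  then have "0 \<le> - incidence_cos l r x / (x * centre_ratio l r)"
    using centre_ratio_pos[of l r] x0 assms by (simp add: divide_le_0_iff)
  then show "\<exists>y. (axis_cos l r has_real_derivative y) (at x) \<and> 0 \<le> y"
    using axis_cos_has_derivative[of l r x] x0 assms by auto
qed

text \<open>On the segment, \<open>axis_cos l r\<close> exceeds 1 before \<open>t = r\<close>, decreases from 1 to its minimum at the
  tangency and then increases again. So the values attained up to \<open>rho\<close> that are at most 1 are all attained on
  the decreasing branch, and they form an interval.\<close>

lemma hyperplane_hits_segment_iff:
  fixes u v :: "'a::euclidean_space"
  assumes l: "0 \<le> l" and r: "0 < r" "r < 1" and u: "norm u = 1" and v: "norm v = 1"
    and rho: "0 \<le> rho" "rho < 1"
  shows "hyperplane l r u \<inter> (\<lambda>t. t *\<^sub>R v) ` {0..rho} \<noteq> {} \<longleftrightarrow>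
           r \<le> rho \<and> axis_cos l r (min rho (tangency_time l r)) \<le> u \<bullet> v"
    (is "?hits \<longleftrightarrow> ?cap")
proof -
  define T where "T = min rho (tangency_time l r)"
  have "?hits \<longleftrightarrow> (\<exists>t\<in>{0..rho}. t *\<^sub>R v \<in> hyperplane l r u)"
    by auto
  also have "\<dots> \<longleftrightarrow> (\<exists>t\<in>{0<..rho}. u \<bullet> v = axis_cos l r t)"
    using ray_point_in_hyperplane_iff[OF l r u v] rho
    by (auto simp: Bex_def) (smt (verit, best))+
  also have "\<dots> \<longleftrightarrow> ?cap"
  proof (intro iffI conjI)
    assume "\<exists>t\<in>{0<..rho}. u \<bullet> v = axis_cos l r t"
    then obtain t where t: "0 < t" "t \<le> rho" "u \<bullet> v = axis_cos l r t"
      by auto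
    show rt: "r \<le> rho"
    proof (rule ccontr)
      assume "\<not> r \<le> rho"
      then have tr: "t < r"
        using t by simp
      have "0 < 1 + t * r + l * (t + r)"
        using t r l by (intro add_pos_nonneg) auto
      then have "1 - incidence_cos l r t < 0"
        using one_minus_incidence_cos[of l r t] one_minus_r2_pos[of l r] t tr l r
        by (simp add: divide_less_0_iff mult_less_0_iff zero_less_mult_iff)
      then have "1 < (incidence_cos l r t)\<^sup>2"
        by (simp add: one_less_power)
      then have "1 < (axis_cos l r t)\<^sup>2"
        using one_minus_axis_cos_sq[of l r t] centre_ratio_pos[of l r] l r t
        by (smt (verit) divide_less_0_iff zero_less_power)
      then have "1 < \<bar>u \<bullet> v\<bar>"
        unfolding t(3) using abs_square_le_1 not_less by blast
      then show False
        using Cauchy_Schwarz_ineq2[of u v] u v by simp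
    qed
    show "axis_cos l r (min rho (tangency_time l r)) \<le> u \<bullet> v"
    proof (cases "t \<le> tangency_time l r")
      case True
      then show ?thesis
        unfolding t(3) using t l r by (intro axis_cos_antimono) auto
    next
      case False
      then show ?thesis
        unfolding t(3) using t l r by (intro axis_cos_mono) auto
    qed
  next
    assume cap: ?cap
    have "continuous_on {r..T} (axis_cos l r)"
    proof (rule DERIV_atLeastAtMost_imp_continuous_on)
      fix x assume "r \<le> x" "x \<le> T"
      then show "\<exists>y. (axis_cos l r has_real_derivative y) (at x)"
        using axis_cos_has_derivative[of l r x] l r by auto
    qed
    moreover have "u \<bullet> v \<le> 1"
      using norm_cauchy_schwarz[of u v] u v by simp
    moreover have "r \<le> T"
      using cap less_tangency_time[OF l r] by (simp add: T_def)
    ultimately obtain t where "r \<le> t" "t \<le> T" "axis_cos l r t = u \<bullet> v"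
      using IVT2'[of "axis_cos l r" T "u \<bullet> v" r] cap axis_cos_self[OF l r] by (auto simp: T_def)
    then show "\<exists>t\<in>{0<..rho}. u \<bullet> v = axis_cos l r t"
      using r by (intro bexI[of _ t]) (auto simp: T_def)
  qed
  finally show ?thesis .
qed

section \<open>Change of variables to the point and angle of entry\<close>

text \<open>A multiple of \<open>(1 - m\<^sup>2) powr ((n - 2) / 2)\<close>, written such that integer powers suffice. For
  \<open>n = 1\<close> it is unbounded at \<open>m = 1\<close>; the integrals below therefore use the form of the
  fundamental theorem of calculus that needs the derivative only in the open interval.\<close>

definition cap_density :: "nat \<Rightarrow> real \<Rightarrow> real" where
  "cap_density n m = unit_ball_vol n * real n / (real n + 1) * (sqrt (1 - m\<^sup>2) ^ n / (1 - m\<^sup>2))"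

lemma cap_density_nonneg: "m\<^sup>2 \<le> 1 \<Longrightarrow> 0 \<le> cap_density n m"
  by (simp add: cap_density_def)

lemma continuous_on_cap_volume: "continuous_on {0..1} (cap_volume n)"
proof -
  have "continuous_on {0..1} (\<lambda>m. integral {m..1} (\<lambda>s. sqrt (1 - s\<^sup>2) ^ n))"
  proof (rule DERIV_continuous_on)
    fix m :: real assume "m \<in> {0..1}"
    then show "((\<lambda>m. integral {m..1} (\<lambda>s. sqrt (1 - s\<^sup>2) ^ n)) has_real_derivative - (sqrt (1 - m\<^sup>2) ^ n)) (at m within {0..1})"
      by (intro integral_has_real_derivative' continuous_intros)
  qed
  then show ?thesis
    unfolding cap_volume_def[abs_def] by (intro continuous_intros) auto
qed

text \<open>The straight cone and the piece of the ball contribute multiples of \<open>w ^ n\<close> and \<open>w ^ n / w\<^sup>2\<close>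
  with \<open>w = sqrt (1 - m\<^sup>2)\<close>; the multiples of \<open>w ^ n\<close> cancel.\<close>

lemma cap_volume_has_derivative:
  assumes m: "0 < m" "m < 1"
  shows "(cap_volume n has_real_derivative - cap_density n m) (at m)"
proof -
  define w where "w = sqrt (1 - m\<^sup>2)"
  have m2: "m\<^sup>2 < 1"
    using m by (simp add: power_less_one_iff)
  then have w: "w > 0" "w\<^sup>2 = 1 - m\<^sup>2"
    by (simp_all add: w_def)
  have "((\<lambda>m. integral {m..1} (\<lambda>s. sqrt (1 - s\<^sup>2) ^ n)) has_real_derivative - (sqrt (1 - m\<^sup>2) ^ n)) (at m within {0..1})"
    using m by (intro integral_has_real_derivative' continuous_intros) auto
  then have int: "((\<lambda>m. integral {m..1} (\<lambda>s. sqrt (1 - s\<^sup>2) ^ n)) has_real_derivative - (w ^ n)) (at m)"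
    using m by (simp add: at_within_Icc_at w_def)
  have root: "((\<lambda>m. sqrt (1 - m\<^sup>2)) has_real_derivative - m / w) (at m)"
    using m2 by (auto intro!: derivative_eq_intros simp: w_def field_simps)
  have "((\<lambda>m. m * sqrt (1 - m\<^sup>2) ^ n / (real n + 1)) has_real_derivative
      (w ^ n + m * (real n * (- m / w * w ^ (n - Suc 0)))) / (real n + 1)) (at m)"
    using DERIV_cdivide[OF DERIV_mult[OF DERIV_ident DERIV_power[OF root, of n]], of "real n + 1"]
    by (simp add: w_def add.commute mult.commute)
  then have "(cap_volume n has_real_derivative unit_ball_vol n *
      ((w ^ n + m * (real n * (- m / w * w ^ (n - Suc 0)))) / (real n + 1) + - (w ^ n))) (at m)"
    unfolding cap_volume_def[abs_def] by (intro DERIV_cmult DERIV_add int)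
  also have "(w ^ n + m * (real n * (- m / w * w ^ (n - Suc 0)))) / (real n + 1) + - (w ^ n)
      = - (real n / (real n + 1) * (w ^ n / w\<^sup>2))"
  proof (cases n)
    case (Suc k)
    have m2_eq: "m\<^sup>2 = 1 - w\<^sup>2"
      using w by simp
    have "m * (real n * (- m / w * w ^ (n - Suc 0))) = - (real n * (w ^ n / w\<^sup>2) * m\<^sup>2)"
      using w(1) by (simp add: Suc power2_eq_square)
    also have "\<dots> = real n * w ^ n - real n * (w ^ n / w\<^sup>2)"
    proof -
      have "w ^ n / w\<^sup>2 * m\<^sup>2 = w ^ n / w\<^sup>2 - w ^ n"
        unfolding m2_eq using w(1) by (simp add: right_diff_distrib)
      then show ?thesis
        unfolding mult.assoc by (simp only: right_diff_distrib)
    qed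
    finally have numerator: "m * (real n * (- m / w * w ^ (n - Suc 0))) = real n * w ^ n - real n * (w ^ n / w\<^sup>2)" .
    have "(W + (N * W - N * P)) / (N + 1) + - W = - (N / (N + 1) * P)" if "0 \<le> N" for W P N :: real
      using that by (simp add: field_simps)
    from this[of "real n" "w ^ n" "w ^ n / w\<^sup>2"] show ?thesis
      unfolding numerator by simp
  qed simp
  also have "unit_ball_vol n * - (real n / (real n + 1) * (w ^ n / w\<^sup>2)) = - cap_density n m"
    unfolding w(2) by (simp add: cap_density_def w_def)
  finally show ?thesis .
qed

lemma cap_volume_1: "0 < n \<Longrightarrow> cap_volume n 1 = 0"
  by (simp add: cap_volume_def)

text \<open>The cap of directions \<open>u\<close> for which the segment is hit, decomposed according to the point of
  entry: the fundamental theorem of calculus for \<open>t \<mapsto> cap_volume n (axis_cos l r t)\<close>, which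
  vanishes at \<open>t = r\<close>.\<close>

lemma cap_volume_as_integral:
  assumes l: "0 \<le> l" and r: "0 < r" "r < 1" and T: "r \<le> T" "T \<le> tangency_time l r" and n: "0 < n"
  shows "(\<integral>\<^sup>+t. ennreal (cap_density n (axis_cos l r t) * (incidence_cos l r t / (t * centre_ratio l r)))
            * indicator {r..T} t \<partial>lborel) = ennreal (cap_volume n (axis_cos l r T))"
proof -
  have q: "0 < centre_ratio l r"
    using centre_ratio_pos l r by simp
  have a: "0 \<le> incidence_cos l r t" if "t \<in> {r..T}" for t
    using that T r l by (subst incidence_cos_nonneg_iff) (auto simp: tangency_time_def)
  have g01: "0 < axis_cos l r t" "axis_cos l r t \<le> 1" if "t \<in> {r..T}" for t
    using axis_cos_pos[of l r t] axis_cos_antimono[of l r r t] axis_cos_self[of l r] that l r T by auto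
  have g1: "axis_cos l r t < 1" if "t \<in> {r<..<T}" for t
    using that T by (intro axis_cos_less_1[OF l r]) auto
  have "((\<lambda>t. cap_density n (axis_cos l r t) * (incidence_cos l r t / (t * centre_ratio l r))) has_integral
      cap_volume n (axis_cos l r T) - cap_volume n (axis_cos l r r)) {r..T}"
  proof (rule fundamental_theorem_of_calculus_interior[OF T(1)])
    have "continuous_on {r..T} (axis_cos l r)"
    proof (rule DERIV_atLeastAtMost_imp_continuous_on)
      fix x assume "r \<le> x" "x \<le> T"
      then show "\<exists>y. (axis_cos l r has_real_derivative y) (at x)"
        using axis_cos_has_derivative[of l r x] l r by auto
    qed
    then show "continuous_on {r..T} (\<lambda>t. cap_volume n (axis_cos l r t))"
    proof (rule continuous_on_compose2[OF continuous_on_cap_volume])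
      show "axis_cos l r ` {r..T} \<subseteq> {0..1}"
      proof (rule image_subsetI)
        fix t assume "t \<in> {r..T}"
        from g01[OF this] show "axis_cos l r t \<in> {0..1}" by simp
      qed
    qed
  next
    fix t assume t: "t \<in> {r<..<T}"
    have "((\<lambda>t. cap_volume n (axis_cos l r t)) has_real_derivative
        - cap_density n (axis_cos l r t) * (- incidence_cos l r t / (t * centre_ratio l r))) (at t)"
      using t g1[OF t] g01[of t] l r
      by (intro DERIV_chain2[OF cap_volume_has_derivative axis_cos_has_derivative]) auto
    then show "((\<lambda>t. cap_volume n (axis_cos l r t)) has_vector_derivative
        cap_density n (axis_cos l r t) * (incidence_cos l r t / (t * centre_ratio l r))) (at t)"
      by (simp add: has_real_derivative_iff_has_vector_derivative)
  qed
  then have "((\<lambda>t. cap_density n (axis_cos l r t) * (incidence_cos l r t / (t * centre_ratio l r))) has_integral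
      cap_volume n (axis_cos l r T)) {r..T}"
    using axis_cos_self[OF l r] cap_volume_1[OF n] by simp
  then show ?thesis
  proof (rule nn_integral_has_integral_lebesgue'[rotated])
    fix t assume t: "t \<in> {r..T}"
    then have "(axis_cos l r t)\<^sup>2 \<le> 1"
      using g01[OF t] by (simp add: power_le_one_iff)
    then show "0 \<le> cap_density n (axis_cos l r t) * (incidence_cos l r t / (t * centre_ratio l r))"
      using a[OF t] t r q by (intro mult_nonneg_nonneg cap_density_nonneg) auto
  qed
qed

text \<open>The density of the measure in the distance \<open>r\<close>; it equals
  \<open>2 * centre_ratio l r ^ n / (1 - r\<^sup>2)\<close>.\<close>

definition distance_weight :: "nat \<Rightarrow> real \<Rightarrow> real \<Rightarrow> real" where
  "distance_weight n l r = 2 * (1 + 2 * l * r + r\<^sup>2) ^ n / (1 - r\<^sup>2) ^ Suc n"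

lemma distance_weight_nonneg:
  "0 \<le> l \<Longrightarrow> 0 \<le> r \<Longrightarrow> r < 1 \<Longrightarrow> 0 \<le> distance_weight n l r"
  unfolding distance_weight_def using one_minus_r2_pos[of l r] denominator_pos[of l r]
  by (intro divide_nonneg_nonneg mult_nonneg_nonneg zero_le_power) auto

text \<open>The last factor is the derivative of \<open>incidence_cos l r t\<close> with respect to \<open>r\<close>. Hence, in the
  variable \<open>a = incidence_cos l r t\<close>, this is the density
  \<open>2 / (1 - t\<^sup>2) * cap_density n a * a\<close>.\<close>

definition crossing_density :: "nat \<Rightarrow> real \<Rightarrow> real \<Rightarrow> real \<Rightarrow> real" where
  "crossing_density n l r t = 2 / (1 - t\<^sup>2) * (cap_density n (incidence_cos l r t) * incidence_cos l r t
     * ((1 - t\<^sup>2) * centre_ratio l r / (t * (1 - r\<^sup>2))))"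

text \<open>The cancellation on which the theorem rests: by the law of sines, replacing the angle at the
  origin by the angle of incidence multiplies \<open>cap_density n\<close> by \<open>q\<^sup>2 / q ^ n\<close>, where
  \<open>q = centre_ratio l r\<close>. Together with \<open>q ^ n\<close> from the weight and \<open>1 / q\<close> from the derivative
  in \<open>t\<close>, a single factor \<open>q\<close> remains, and this is the one in the derivative of the angle of
  incidence with respect to \<open>r\<close>.\<close>

lemma weighted_cap_density:
  assumes l: "0 \<le> l" and r: "0 < r" "r < 1" and t: "0 < t" "t < 1" and n: "0 < n"
  shows "distance_weight n l r * (cap_density n (axis_cos l r t) * (incidence_cos l r t / (t * centre_ratio l r)))
           = crossing_density n l r t"
proof -
  define q E a c where "q = centre_ratio l r" and "E = 1 - r\<^sup>2" and "a = incidence_cos l r t"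
    and "c = unit_ball_vol n * real n / (real n + 1)"
  define W where "W = sqrt (1 - a\<^sup>2) ^ n / (1 - a\<^sup>2)"
  have pos: "q > 0" "E > 0"
    using centre_ratio_pos[of l r] one_minus_r2_pos[of l r] l r by (simp_all add: q_def E_def)
  have t2: "1 - t\<^sup>2 > 0"
    using t by (simp add: power_less_one_iff)
  have f: "distance_weight n l r = 2 * q ^ n / E"
    unfolding distance_weight_def q_def centre_ratio_def E_def by (simp add: power_divide)
  have "1 - (axis_cos l r t)\<^sup>2 = (1 - a\<^sup>2) / q\<^sup>2"
    unfolding a_def q_def using l r t by (intro one_minus_axis_cos_sq) auto
  then have "cap_density n (axis_cos l r t) = c * (W * (q\<^sup>2 / q ^ n))"
    using pos by (simp add: cap_density_def c_def W_def real_sqrt_divide power_divide)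
  then have "distance_weight n l r * (cap_density n (axis_cos l r t) * (a / (t * q)))
      = 2 * q ^ n / E * (c * (W * (q\<^sup>2 / q ^ n)) * (a / (t * q)))"
    by (simp add: f)
  also have "\<dots> = 2 * (c * W * a * (q / (t * E)))"
    using pos t by (simp add: power2_eq_square mult_ac)
  also have "\<dots> = 2 / (1 - t\<^sup>2) * (c * W * a * ((1 - t\<^sup>2) * q / (t * E)))"
    using t2 by simp
  finally show ?thesis
    unfolding crossing_density_def cap_density_def c_def W_def a_def q_def E_def .
qed

text \<open>For fixed \<open>t\<close> the cosine of incidence increases with \<open>r\<close> to the value 1 at \<open>r = t\<close>. The
  constraint that \<open>t v\<close> is a point of entry cuts this down to values from 0 to 1, and
  \<open>- sqrt (1 - a\<^sup>2) ^ n / n\<close> is a primitive of \<open>a * (sqrt (1 - a\<^sup>2) ^ n / (1 - a\<^sup>2))\<close>.\<close>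

lemma crossing_density_integral:
  assumes l: "0 \<le> l" and t: "0 < t" "t < 1" and n: "0 < n"
  shows "(\<integral>\<^sup>+r. ennreal (crossing_density n l r t) * indicator {r. 0 < r \<and> r \<le> t \<and> 0 \<le> incidence_cos l r t} r \<partial>lborel)
           = ennreal (unit_ball_vol n / (real n + 1) * (2 / (1 - t\<^sup>2)))"
proof -
  define a where "a r = incidence_cos l r t" for r
  define a' where "a' r = (1 - t\<^sup>2) * centre_ratio l r / (t * (1 - r\<^sup>2))" for r
  define c where "c = unit_ball_vol n / (real n + 1) * (2 / (1 - t\<^sup>2))"
  have t2: "1 - t\<^sup>2 > 0"
    using t by (simp add: power_less_one_iff)
  have c: "c \<ge> 0"
    using t2 by (simp add: c_def)
  have deriv: "(a has_real_derivative a' r) (at r)" and a'_pos: "0 < a' r" if "0 \<le> r" "r \<le> t" for r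
  proof -
    show "(a has_real_derivative a' r) (at r)"
      unfolding a_def[abs_def] a'_def using incidence_cos_has_derivative[of l r t] l t that by simp
    show "0 < a' r"
      unfolding a'_def using t2 centre_ratio_pos[of l r] one_minus_r2_pos[of l r] l t that by simp
  qed
  have mono: "a x < a y" if "0 \<le> x" "x < y" "y \<le> t" for x y
  proof (rule DERIV_pos_imp_increasing[OF that(2)])
    fix z assume "x \<le> z" "z \<le> y"
    then have "0 \<le> z" "z \<le> t"
      using that by auto
    from deriv[OF this] a'_pos[OF this] show "\<exists>d. (a has_real_derivative d) (at z) \<and> 0 < d"
      by blast
  qed
  have cont: "continuous_on {0..t} a"
    by (rule DERIV_atLeastAtMost_imp_continuous_on) (rule exI, rule deriv)
  have a0: "a 0 \<le> 0"
    using l t by (simp add: a_def incidence_cos_def divide_nonpos_pos mult_nonneg_nonneg)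
  have at: "a t = 1"
    using incidence_cos_self[of l t] l t by (simp add: a_def)
  \<comment> \<open>\<open>r0\<close> is the distance at which the incidence at \<open>t v\<close> becomes tangential\<close>
  obtain r0 where r0: "0 \<le> r0" "r0 \<le> t" "a r0 = 0"
    using IVT'[of a 0 0 t] cont a0 at t by auto
  have sign: "0 \<le> a r \<longleftrightarrow> r0 \<le> r" if "0 \<le> r" "r \<le> t" for r
    using mono[of r r0] mono[of r0 r] r0 that by (cases r r0 rule: linorder_cases) auto
  \<comment> \<open>strictness is needed for the derivative of the square root in the interior\<close>
  have less_1: "a r < 1" if "0 \<le> r" "r < t" for r
    using mono[of r t] at that by simp
  have "((\<lambda>r. crossing_density n l r t) has_integral
      - c * sqrt (1 - (a t)\<^sup>2) ^ n - - c * sqrt (1 - (a r0)\<^sup>2) ^ n) {r0..t}"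
  proof (rule fundamental_theorem_of_calculus_interior[OF r0(2)])
    show "continuous_on {r0..t} (\<lambda>r. - c * sqrt (1 - (a r)\<^sup>2) ^ n)"
      by (intro continuous_intros continuous_on_subset[OF cont]) (use r0 in auto)
  next
    fix r assume r: "r \<in> {r0<..<t}"
    then have r': "0 \<le> r" "r \<le> t" "0 \<le> a r" "a r < 1"
      using r0 sign[of r] less_1[of r] by auto
    define w where "w = sqrt (1 - (a r)\<^sup>2)"
    have "(a r)\<^sup>2 < 1"
      using r' by (simp add: power_less_one_iff)
    then have w: "w > 0" "w\<^sup>2 = 1 - (a r)\<^sup>2"
      by (simp_all add: w_def)
    have "((\<lambda>r. sqrt (1 - (a r)\<^sup>2)) has_real_derivative - a r * a' r / w) (at r)"
      using \<open>(a r)\<^sup>2 < 1\<close> by (auto intro!: derivative_eq_intros deriv[OF r'(1,2)] simp: w_def field_simps)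
    from DERIV_cmult[OF DERIV_power[OF this, of n], of "- c"]
    have "((\<lambda>r. - c * sqrt (1 - (a r)\<^sup>2) ^ n) has_real_derivative
        - c * (real n * (- a r * a' r / w * w ^ (n - Suc 0)))) (at r)"
      by (simp add: w_def)
    also have "- c * (real n * (- a r * a' r / w * w ^ (n - Suc 0))) = c * real n * (w ^ n / w\<^sup>2) * a r * a' r"
      using w(1) n by (cases n) (simp_all add: power2_eq_square)
    also have "\<dots> = crossing_density n l r t"
      unfolding w(2) crossing_density_def cap_density_def c_def
      by (simp add: w_def a_def a'_def)
    finally show "((\<lambda>r. - c * sqrt (1 - (a r)\<^sup>2) ^ n) has_vector_derivative crossing_density n l r t) (at r)"
      by (simp add: has_real_derivative_iff_has_vector_derivative)
  qed
  moreover have "- c * sqrt (1 - (a t)\<^sup>2) ^ n - - c * sqrt (1 - (a r0)\<^sup>2) ^ n = c"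
    using at r0(3) n by (simp add: zero_power)
  ultimately have int: "((\<lambda>r. crossing_density n l r t) has_integral c) {r0..t}"
    by (simp only:)
  have "(\<integral>\<^sup>+r. ennreal (crossing_density n l r t) * indicator {r. 0 < r \<and> r \<le> t \<and> 0 \<le> incidence_cos l r t} r \<partial>lborel)
      = (\<integral>\<^sup>+r. ennreal (crossing_density n l r t) * indicator {r0..t} r \<partial>lborel)"
  proof (rule nn_integral_cong_AE)
    have "AE r in lborel. r \<noteq> (0::real)"
      by (rule AE_lborel_singleton)
    then show "AE r in lborel. ennreal (crossing_density n l r t) * indicator {r. 0 < r \<and> r \<le> t \<and> 0 \<le> incidence_cos l r t} r
        = ennreal (crossing_density n l r t) * indicator {r0..t} r"
    proof eventually_elim
      case (elim r)
      have "0 < r \<and> r \<le> t \<and> 0 \<le> incidence_cos l r t \<longleftrightarrow> r \<in> {r0..t}"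
        using sign[of r] r0 elim by (auto simp: a_def)
      then show ?case by (simp add: indicator_def)
    qed
  qed
  also have "\<dots> = ennreal c"
  proof (rule nn_integral_has_integral_lebesgue'[OF _ int])
    fix r assume r: "r \<in> {r0..t}"
    then have r': "0 \<le> r" "r \<le> t" "0 \<le> a r"
      using r0 sign[of r] by auto
    have "a r \<le> 1"
      using less_1[of r] at r' by (cases "r = t") auto
    then have "(a r)\<^sup>2 \<le> 1"
      using r' by (simp add: power_le_one_iff)
    then show "0 \<le> crossing_density n l r t"
      unfolding crossing_density_def using a'_pos[OF r'(1,2)] r' t2
      by (intro mult_nonneg_nonneg cap_density_nonneg) (auto simp: a_def a'_def)
  qed
  finally show ?thesis
    by (simp add: c_def)
qed

lemma
  assumes [measurable]: "f \<in> borel_measurable M" "g \<in> borel_measurable M"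
  shows incidence_cos_measurable [measurable]: "(\<lambda>x. incidence_cos l (f x) (g x)) \<in> borel_measurable M"
    and axis_cos_measurable [measurable]: "(\<lambda>x. axis_cos l (f x) (g x)) \<in> borel_measurable M"
    and centre_ratio_measurable [measurable]: "(\<lambda>x. centre_ratio l (f x)) \<in> borel_measurable M"
  unfolding incidence_cos_def axis_cos_def centre_ratio_def by measurable

lemma cap_density_measurable [measurable]:
  assumes [measurable]: "f \<in> borel_measurable M"
  shows "(\<lambda>x. cap_density n (f x)) \<in> borel_measurable M"
  unfolding cap_density_def by measurable

lemma crossing_density_measurable [measurable]:
  assumes [measurable]: "f \<in> borel_measurable M" "g \<in> borel_measurable M"
  shows "(\<lambda>x. crossing_density n l (f x) (g x)) \<in> borel_measurable M"
  unfolding crossing_density_def by measurable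

text \<open>Tonelli: the caps are written as integrals over the point of entry, and the integral over \<open>r\<close>
  is then taken first. The measurability of the integrand \<open>p\<close> follows from its
  representation as a partial integral.\<close>

lemma hitting_integral:
  assumes l: "0 \<le> l" and rho: "0 \<le> rho" "rho < 1" and n: "0 < n"
  defines "p \<equiv> \<lambda>r. ennreal (distance_weight n l r)
      * ennreal (cap_volume n (axis_cos l r (min rho (tangency_time l r)))) * indicator {0<..rho} r"
  shows "p \<in> borel_measurable borel"
    and "(\<integral>\<^sup>+r. p r \<partial>lborel) = ennreal (unit_ball_vol n / (real n + 1) * (2 * artanh rho))"
proof -
  define D where "D = {(r, t). 0 < r \<and> r \<le> t \<and> t \<le> rho \<and> 0 \<le> incidence_cos l r t}"
  define H where "H = (\<lambda>(r, t). ennreal (crossing_density n l r t) * indicator D (r, t))"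
  have "Measurable.pred (borel \<Otimes>\<^sub>M borel) (\<lambda>p. 0 < fst p \<and> fst p \<le> snd p \<and> snd p \<le> rho \<and>
      0 \<le> incidence_cos l (fst p) (snd p))"
    by measurable
  then have D [measurable]: "D \<in> sets (borel \<Otimes>\<^sub>M borel)"
    unfolding pred_def by (simp add: D_def space_pair_measure split_beta')
  have H [measurable]: "H \<in> borel_measurable (lborel \<Otimes>\<^sub>M lborel)"
    unfolding H_def split_beta' by measurable
  have p: "p = (\<lambda>r. \<integral>\<^sup>+t. H (r, t) \<partial>lborel)"
  proof (rule ext)
    fix r :: real
    show "p r = (\<integral>\<^sup>+t. H (r, t) \<partial>lborel)"
    proof (cases "r \<in> {0<..rho}")
      case True
      then have r: "0 < r" "r \<le> rho" "r < 1"
        using rho by auto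
      define T where "T = min rho (tangency_time l r)"
      have T: "r \<le> T" "T \<le> tangency_time l r" "T \<le> rho"
        using less_tangency_time[OF l r(1,3)] r by (auto simp: T_def)
      have "(\<integral>\<^sup>+t. H (r, t) \<partial>lborel)
          = (\<integral>\<^sup>+t. ennreal (distance_weight n l r) * (ennreal (cap_density n (axis_cos l r t) *
              (incidence_cos l r t / (t * centre_ratio l r))) * indicator {r..T} t) \<partial>lborel)"
      proof (rule nn_integral_cong)
        fix t :: real
        show "H (r, t) = ennreal (distance_weight n l r) * (ennreal (cap_density n (axis_cos l r t) *
              (incidence_cos l r t / (t * centre_ratio l r))) * indicator {r..T} t)"
        proof (cases "t \<in> {r..rho}")
          case True
          then have "(r, t) \<in> D \<longleftrightarrow> t \<in> {r..T}"
            using incidence_cos_nonneg_iff[OF l r(1,3), of t] r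
            by (auto simp: D_def T_def tangency_time_def)
          moreover have "ennreal (crossing_density n l r t) = ennreal (distance_weight n l r) *
              ennreal (cap_density n (axis_cos l r t) * (incidence_cos l r t / (t * centre_ratio l r)))"
            using weighted_cap_density[OF l r(1,3) _ _ n, of t] distance_weight_nonneg[OF l, of r n] True r rho
            by (subst ennreal_mult'[symmetric]) auto
          ultimately show ?thesis
            by (simp add: H_def indicator_def)
        next
          case False
          then show ?thesis
            using T by (auto simp: H_def D_def indicator_def)
        qed
      qed
      also have "\<dots> = ennreal (distance_weight n l r) * ennreal (cap_volume n (axis_cos l r T))"
        by (subst nn_integral_cmult, measurable) (simp only: cap_volume_as_integral[OF l r(1,3) T(1,2) n])
      finally show ?thesis
        using True by (simp add: p_def T_def)
    next
      case False
      then have "H (r, t) = 0" for t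
        by (auto simp: H_def D_def)
      with False show ?thesis by (simp add: p_def)
    qed
  qed
  show "p \<in> borel_measurable borel"
    unfolding p using lborel.borel_measurable_nn_integral_fst[OF H] by simp
  have "(\<integral>\<^sup>+r. p r \<partial>lborel) = (\<integral>\<^sup>+t. (\<integral>\<^sup>+r. H (r, t) \<partial>lborel) \<partial>lborel)"
    unfolding p by (rule lborel_pair.Fubini'[symmetric]) (use H in \<open>simp add: case_prod_eta\<close>)
  also have "\<dots> = (\<integral>\<^sup>+t. ennreal (unit_ball_vol n / (real n + 1) * (2 / (1 - t\<^sup>2))) * indicator {0..rho} t \<partial>lborel)"
  proof (rule nn_integral_cong_AE)
    have "AE t in lborel. t \<noteq> (0::real)"
      by (rule AE_lborel_singleton)
    then show "AE t in lborel. (\<integral>\<^sup>+r. H (r, t) \<partial>lborel)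
        = ennreal (unit_ball_vol n / (real n + 1) * (2 / (1 - t\<^sup>2))) * indicator {0..rho} t"
    proof eventually_elim
      case (elim t)
      show ?case
      proof (cases "t \<in> {0<..rho}")
        case True
        then have "(\<integral>\<^sup>+r. H (r, t) \<partial>lborel)
          = (\<integral>\<^sup>+r. ennreal (crossing_density n l r t) * indicator {r. 0 < r \<and> r \<le> t \<and> 0 \<le> incidence_cos l r t} r \<partial>lborel)"
          by (intro nn_integral_cong) (auto simp: H_def D_def indicator_def)
        with True show ?thesis
          using crossing_density_integral[OF l _ _ n, of t] rho by simp
      next
        case False
        then have "H (r, t) = 0" for r
          using elim by (auto simp: H_def D_def)
        with False elim show ?thesis by simp
      qed
    qed
  qed
  also have "\<dots> = ennreal (unit_ball_vol n / (real n + 1) * (2 * artanh rho))"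
  proof (rule nn_integral_has_integral_lebesgue')
    fix t assume "t \<in> {0..rho}"
    then have "t\<^sup>2 < 1"
      using rho by (simp add: power_less_one_iff)
    then show "0 \<le> unit_ball_vol n / (real n + 1) * (2 / (1 - t\<^sup>2))"
      by simp
  next
    have "((\<lambda>t. unit_ball_vol n / (real n + 1) * (2 / (1 - t\<^sup>2))) has_integral
        unit_ball_vol n / (real n + 1) * (2 * artanh rho) - unit_ball_vol n / (real n + 1) * (2 * artanh 0)) {0..rho}"
    proof (rule fundamental_theorem_of_calculus[OF rho(1)])
      fix t assume t: "t \<in> {0..rho}"
      have "((\<lambda>t. unit_ball_vol n / (real n + 1) * (2 * artanh t)) has_real_derivative
          unit_ball_vol n / (real n + 1) * (2 * (1 / (1 - t\<^sup>2)))) (at t within {0..rho})"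
        by (intro DERIV_cmult artanh_real_has_field_derivative) (use t rho in auto)
      then show "((\<lambda>t. unit_ball_vol n / (real n + 1) * (2 * artanh t)) has_vector_derivative
          unit_ball_vol n / (real n + 1) * (2 / (1 - t\<^sup>2))) (at t within {0..rho})"
        by (simp add: has_real_derivative_iff_has_vector_derivative)
    qed
    then show "((\<lambda>t. unit_ball_vol n / (real n + 1) * (2 / (1 - t\<^sup>2))) has_integral
        unit_ball_vol n / (real n + 1) * (2 * artanh rho)) {0..rho}"
      by simp
  qed
  finally show "(\<integral>\<^sup>+r. p r \<partial>lborel) = ennreal (unit_ball_vol n / (real n + 1) * (2 * artanh rho))" .
qed

section \<open>The measure of the hyperplanes that meet a set\<close>

abbreviation hyperplane_parameters :: "(real \<times> 'a::euclidean_space) measure" where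
  "hyperplane_parameters \<equiv> restrict_space lborel {0<..<1} \<Otimes>\<^sub>M sphere_measure"

lemma space_hyperplane_parameters:
  "space (hyperplane_parameters :: (real \<times> 'a::euclidean_space) measure) = {0<..<1} \<times> sphere 0 1"
  by (simp add: space_pair_measure space_restrict_space)

lemma borel_sets_hyperplane_parameters:
  fixes K :: "(real \<times> 'a::euclidean_space) set"
  assumes "K \<in> sets borel"
  shows "K \<inter> {0<..<1} \<times> sphere 0 1 \<in> sets hyperplane_parameters"
proof -
  have "(\<lambda>x. x) \<in> restrict_space lborel {0<..<1::real} \<rightarrow>\<^sub>M borel"
    by (intro measurable_restrict_space1) simp
  moreover have "(\<lambda>x. x) \<in> (sphere_measure :: 'a measure) \<rightarrow>\<^sub>M borel"
    unfolding measurable_cong_sets[OF sets_sphere_measure refl] by (intro measurable_restrict_space1) simp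
  ultimately have "(\<lambda>p. (fst p, snd p)) \<in> (hyperplane_parameters :: (real \<times> 'a) measure) \<rightarrow>\<^sub>M borel \<Otimes>\<^sub>M borel"
    by (intro measurable_Pair measurable_compose[OF measurable_fst] measurable_compose[OF measurable_snd])
  then have "(\<lambda>p. p) \<in> (hyperplane_parameters :: (real \<times> 'a) measure) \<rightarrow>\<^sub>M borel"
    by (simp add: borel_prod)
  from measurable_sets[OF this assms] show ?thesis
    by (simp add: space_hyperplane_parameters)
qed

text \<open>The incidence relation between points of \<open>C\<close> and parameters is closed, and projections along
  compact sets are closed.\<close>

lemma hitting_parameters_measurable:
  fixes C :: "'a::euclidean_space set"
  assumes lam: "0 \<le> lam" and C: "compact C" "C \<subseteq> hyp_space"
  shows "{p \<in> {0<..<1} \<times> sphere 0 1. hyperplane lam (fst p) (snd p) \<inter> C \<noteq> {}} \<in> sets hyperplane_parameters"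
proof -
  define X where "X = {0<..<1::real} \<times> sphere (0::'a) 1"
  define radius where "radius r = (1 - r\<^sup>2) / (2 * (lam + r))" for r
  define U where "U = {z \<in> C \<times> X. norm (fst z - (fst (snd z) + radius (fst (snd z))) *\<^sub>R snd (snd z))
      - radius (fst (snd z)) = 0}"
  have "closedin (top_of_set (C \<times> X)) U"
    unfolding U_def radius_def
    by (intro continuous_closedin_preimage_constant continuous_intros) (use lam in \<open>auto simp: X_def\<close>)
  then have "closedin (top_of_set X) {p. \<exists>x. x \<in> C \<and> (x, p) \<in> U}"
    by (rule closedin_compact_projection[OF C(1)])
  also have "{p. \<exists>x. x \<in> C \<and> (x, p) \<in> U} = {p \<in> X. hyperplane lam (fst p) (snd p) \<inter> C \<noteq> {}}"
  proof -
    have "x \<in> hyperplane lam r u \<longleftrightarrow> norm (x - (r + radius r) *\<^sub>R u) - radius r = 0" if "x \<in> C" for x u r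
      using C(2) that by (auto simp: hyperplane_def radius_def Let_def)
    then show ?thesis
      unfolding U_def by force
  qed
  finally obtain K where "closed K" "{p \<in> X. hyperplane lam (fst p) (snd p) \<inter> C \<noteq> {}} = X \<inter> K"
    unfolding closedin_closed by blast
  then show ?thesis
    using borel_sets_hyperplane_parameters[of K] by (simp add: X_def Int_commute)
qed

lemma hyperplane_vimage_hits:
  fixes C :: "'a::euclidean_space set"
  shows "(\<lambda>(r, u). hyperplane lam r u) -` hits lam C \<inter> space hyperplane_parameters
           = {p \<in> {0<..<1} \<times> sphere 0 1. hyperplane lam (fst p) (snd p) \<inter> C \<noteq> {}}"
  unfolding space_hyperplane_parameters hits_def Hyp_def by force

lemma hyperplane_measurable:
  assumes "0 \<le> lam"
  shows "(\<lambda>(r, u). hyperplane lam r u) \<in> (hyperplane_parameters :: (real \<times> 'a::euclidean_space) measure) \<rightarrow>\<^sub>M hyp_sigma lam"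
  unfolding hyp_sigma_def
proof (rule measurable_measure_of)
  show "{hits lam C |C :: 'a set. compact C \<and> C \<subseteq> hyp_space} \<subseteq> Pow (Hyp lam)"
    by (auto simp: hits_def)
  show "(\<lambda>(r, u). hyperplane lam r u) \<in> space (hyperplane_parameters :: (real \<times> 'a) measure) \<rightarrow> Hyp lam"
    unfolding space_hyperplane_parameters Hyp_def by force
  fix \<A> assume "\<A> \<in> {hits lam C |C :: 'a set. compact C \<and> C \<subseteq> hyp_space}"
  then show "(\<lambda>(r, u). hyperplane lam r u) -` \<A> \<inter> space hyperplane_parameters \<in> sets hyperplane_parameters"
    using hitting_parameters_measurable[OF assms] by (auto simp only: hyperplane_vimage_hits mem_Collect_eq)
qed

lemma emeasure_hyperplane_measure_hits:
  fixes C :: "'a::euclidean_space set"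
  assumes \<gamma>: "0 \<le> \<gamma>" and lam: "0 \<le> lam" and C: "compact C" "C \<subseteq> hyp_space" and n: "DIM('a) = Suc n"
  shows "emeasure (hyperplane_measure \<gamma> lam) (hits lam C) =
    (\<integral>\<^sup>+r. ennreal \<gamma> * ennreal (distance_weight n lam r)
        * emeasure sphere_measure {u \<in> sphere 0 1. hyperplane lam r u \<inter> C \<noteq> {}} * indicator {0<..<1} r \<partial>lborel)"
proof -
  define P where "P = (hyperplane_parameters :: (real \<times> 'a) measure)"
  define W where "W = (\<lambda>(r, u :: 'a). ennreal (\<gamma> * (2 * (1 + 2 * lam * r + r\<^sup>2) ^ (DIM('a) - 1) / (1 - r\<^sup>2) ^ DIM('a))))"
  define B where "B = {p \<in> {0<..<1} \<times> sphere (0::'a) 1. hyperplane lam (fst p) (snd p) \<inter> C \<noteq> {}}"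
  interpret finite_measure "sphere_measure :: 'a measure"
    by (rule finite_measure_sphere_measure)
  have id: "(\<lambda>x. x) \<in> restrict_space lborel {0<..<1::real} \<rightarrow>\<^sub>M borel"
    by (intro measurable_restrict_space1) simp
  have [measurable]: "fst \<in> P \<rightarrow>\<^sub>M borel"
    unfolding P_def by (rule measurable_compose[OF measurable_fst id])
  have W [measurable]: "W \<in> borel_measurable P"
    unfolding W_def split_beta' by measurable
  have B [measurable]: "B \<in> sets P"
    unfolding B_def P_def by (rule hitting_parameters_measurable[OF lam C])
  have "hits lam C \<in> sets (hyp_sigma lam)"
    unfolding hyp_sigma_def using C
    by (subst sets_measure_of) (auto simp: hits_def intro!: sigma_sets.Basic exI[of _ C])
  moreover have "(\<lambda>(r, u). hyperplane lam r u) \<in> density P W \<rightarrow>\<^sub>M hyp_sigma lam"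
    using hyperplane_measurable[OF lam] by (simp add: P_def)
  moreover have "hyperplane_measure \<gamma> lam = distr (density P W) (hyp_sigma lam) (\<lambda>(r, u). hyperplane lam r u)"
    unfolding hyperplane_measure_def P_def W_def ..
  ultimately have "emeasure (hyperplane_measure \<gamma> lam) (hits lam C)
      = emeasure (density P W) ((\<lambda>(r, u). hyperplane lam r u) -` hits lam C \<inter> space (density P W))"
    by (simp only: emeasure_distr)
  also have "(\<lambda>(r, u). hyperplane lam r u) -` hits lam C \<inter> space (density P W) = B"
    unfolding space_density P_def hyperplane_vimage_hits B_def ..
  also have "emeasure (density P W) B = (\<integral>\<^sup>+p. W p * indicator B p \<partial>P)"
    by (rule emeasure_density) measurable
  also have "\<dots> = (\<integral>\<^sup>+r. \<integral>\<^sup>+u. W (r, u) * indicator B (r, u) \<partial>sphere_measure \<partial>restrict_space lborel {0<..<1})"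
    unfolding P_def by (rule nn_integral_fst[symmetric]) (fold P_def, measurable)
  also have "\<dots> = (\<integral>\<^sup>+r. (\<integral>\<^sup>+u. W (r, u) * indicator B (r, u) \<partial>sphere_measure) * indicator {0<..<1} r \<partial>lborel)"
    by (rule nn_integral_restrict_space) simp
  also have "\<dots> = (\<integral>\<^sup>+r. ennreal \<gamma> * ennreal (distance_weight n lam r)
        * emeasure sphere_measure {u \<in> sphere 0 1. hyperplane lam r u \<inter> C \<noteq> {}} * indicator {0<..<1} r \<partial>lborel)"
  proof (rule nn_integral_cong)
    fix r :: real
    show "(\<integral>\<^sup>+u. W (r, u) * indicator B (r, u) \<partial>sphere_measure) * indicator {0<..<1} r
        = ennreal \<gamma> * ennreal (distance_weight n lam r)
            * emeasure sphere_measure {u \<in> sphere 0 1. hyperplane lam r u \<inter> C \<noteq> {}} * indicator {0<..<1} r"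
    proof (cases "r \<in> {0<..<1}")
      case True
      define A where "A = {u \<in> sphere 0 1. hyperplane lam r u \<inter> C \<noteq> {}}"
      have slice: "Pair r -` B = A"
        using True by (auto simp: A_def B_def)
      have A: "A \<in> sets sphere_measure"
        using sets_Pair1[of B "restrict_space lborel {0<..<1}" sphere_measure r] B unfolding P_def slice by simp
      have "indicator B (r, u) = (indicator A u :: ennreal)" for u
        using slice by (auto simp: indicator_def)
      moreover have "W (r, u) = ennreal \<gamma> * ennreal (distance_weight n lam r)" for u
        unfolding W_def distance_weight_def n using ennreal_mult'[OF \<gamma>]
        by (simp del: power_Suc times_divide_eq_right)
      ultimately have "(\<integral>\<^sup>+u. W (r, u) * indicator B (r, u) \<partial>sphere_measure)
          = ennreal \<gamma> * ennreal (distance_weight n lam r) * emeasure sphere_measure A"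
        using A by (simp add: nn_integral_cmult)
      then show ?thesis
        by (simp add: A_def)
    qed simp
  qed
  finally show ?thesis .
qed

text \<open>The constant of the theorem, as obtained from the cap density: the mean of the positive part of
  \<open>u \<bullet> v\<close> over the unit sphere of dimension \<open>n\<close>.\<close>

lemma unit_ball_vol_ratio:
  "unit_ball_vol n / (real n + 1) / unit_ball_vol (Suc n)
     = Gamma ((real n + 1) / 2) / (2 * sqrt pi * Gamma ((real n + 2) / 2))"
proof -
  have G: "Gamma ((real n + 1) / 2 + 1) = (real n + 1) / 2 * Gamma ((real n + 1) / 2)"
    by (rule Gamma_plus1) (auto simp: nonpos_Ints_def)
  have pos: "Gamma ((real n + 1) / 2) > 0" "Gamma ((real n + 2) / 2) > 0"
    by (auto intro!: Gamma_real_pos)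
  have p: "pi powr ((real n + 1) / 2) = pi powr (real n / 2) * sqrt pi"
    by (simp add: add_divide_distrib powr_add powr_half_sqrt)
  have h: "real n / 2 + 1 = (real n + 2) / 2" "real (Suc n) / 2 + 1 = (real n + 1) / 2 + 1" "real (Suc n) / 2 = (real n + 1) / 2"
    by (simp_all add: field_simps)
  show ?thesis
    unfolding unit_ball_vol_def h G p using pos by (simp add: divide_simps)
qed

theorem corollary4p7:
  fixes \<gamma> lam h :: real and L :: "'a::euclidean_space set"
  assumes "2 \<le> DIM('a)"
    and "0 < \<gamma>"
    and "0 \<le> lam" and "lam \<le> 1"
    and "0 \<le> h"
    and "geodesic_segment_from 0 h L"
  shows "emeasure (hyperplane_measure \<gamma> lam) (hits lam L) =
           ennreal (\<gamma> * (Gamma (real DIM('a) / 2) / (2 * sqrt pi * Gamma ((real DIM('a) + 1) / 2))) * h)"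
proof -
  obtain n where n: "DIM('a) = Suc n" "0 < n"
    using assms(1) by (cases "DIM('a)") auto
  define rho where "rho = tanh (h / 2)"
  have rho: "0 \<le> rho" "rho < 1"
    using assms(5) tanh_real_lt_1 by (auto simp: rho_def)
  obtain v where v: "norm v = 1" and L: "L = (\<lambda>t. t *\<^sub>R v) ` {0..rho}"
    using geodesic_segment_from_origin[OF assms(5,6)] unfolding rho_def by blast
  have "compact L"
    unfolding L by (intro compact_continuous_image continuous_intros) auto
  moreover have "L \<subseteq> hyp_space"
    unfolding L using v rho by auto
  ultimately have "emeasure (hyperplane_measure \<gamma> lam) (hits lam L) =
    (\<integral>\<^sup>+r. ennreal \<gamma> * ennreal (distance_weight n lam r)
        * emeasure sphere_measure {u \<in> sphere 0 1. hyperplane lam r u \<inter> L \<noteq> {}} * indicator {0<..<1} r \<partial>lborel)"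
    by (intro emeasure_hyperplane_measure_hits) (use assms n in auto)
  also have "\<dots> = (\<integral>\<^sup>+r. ennreal (\<gamma> / unit_ball_vol (Suc n)) * (ennreal (distance_weight n lam r)
      * ennreal (cap_volume n (axis_cos lam r (min rho (tangency_time lam r)))) * indicator {0<..rho} r) \<partial>lborel)"
  proof (rule nn_integral_cong_AE)
    \<comment> \<open>at \<open>r = rho\<close> the cap is a single point, to which the formula for proper caps does not apply\<close>
    have "AE r in lborel. r \<noteq> rho"
      by (rule AE_lborel_singleton)
    then show "AE r in lborel. ennreal \<gamma> * ennreal (distance_weight n lam r)
        * emeasure sphere_measure {u \<in> sphere 0 1. hyperplane lam r u \<inter> L \<noteq> {}} * indicator {0<..<1} r
        = ennreal (\<gamma> / unit_ball_vol (Suc n)) * (ennreal (distance_weight n lam r)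
      * ennreal (cap_volume n (axis_cos lam r (min rho (tangency_time lam r)))) * indicator {0<..rho} r)"
    proof eventually_elim
      case (elim r)
      define m where "m = axis_cos lam r (min rho (tangency_time lam r))"
      consider "r \<in> {0<..<rho}" | "r \<in> {rho<..<1}" "0 < r" | "r \<notin> {0<..<1}"
        using elim by fastforce
      then show ?case
      proof cases
        case 1
        then have r: "0 < r" "r < 1" "r < rho"
          using rho by auto
        have T: "r < min rho (tangency_time lam r)"
          using less_tangency_time[OF assms(3) r(1,2)] r(3) by simp
        have m: "0 < m" "m < 1"
          unfolding m_def using axis_cos_pos[OF assms(3) r(1,2)] axis_cos_less_1[OF assms(3) r(1,2) T] T r by auto
        have "{u \<in> sphere 0 1. hyperplane lam r u \<inter> L \<noteq> {}} = {u \<in> sphere 0 1. m \<le> u \<bullet> v}"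
          unfolding L m_def using hyperplane_hits_segment_iff[OF assms(3) r(1,2) _ v rho] r by auto
        then have "emeasure sphere_measure {u \<in> sphere 0 1. hyperplane lam r u \<inter> L \<noteq> {}}
            = ennreal (cap_volume n m / unit_ball_vol (Suc n))"
          using emeasure_sphere_cap[OF v m n(1)] by simp
        moreover have "ennreal \<gamma> * D * ennreal (cap_volume n m / unit_ball_vol (Suc n))
            = ennreal (\<gamma> / unit_ball_vol (Suc n)) * (D * ennreal (cap_volume n m))" for D
        proof -
          have "ennreal \<gamma> * ennreal (cap_volume n m / unit_ball_vol (Suc n))
              = ennreal (\<gamma> / unit_ball_vol (Suc n)) * ennreal (cap_volume n m)"
            using assms(2) by (simp add: ennreal_mult'[symmetric])
          then show ?thesis
            by (metis mult.assoc mult.commute)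
        qed
        ultimately show ?thesis
          using r by (simp add: m_def[symmetric])
      next
        case 2
        then have "{u \<in> sphere 0 1. hyperplane lam r u \<inter> L \<noteq> {}} = {}"
          unfolding L using hyperplane_hits_segment_iff[OF assms(3) _ _ _ v rho, of r] by auto
        then have "emeasure sphere_measure {u \<in> sphere 0 1. hyperplane lam r u \<inter> L \<noteq> {}} = 0"
          by (simp only: emeasure_empty)
        with 2 show ?thesis by (simp only: indicator_simps) simp
      next
        case 3
        then show ?thesis
          using rho by (auto simp: indicator_def)
      qed
    qed
  qed
  also have "\<dots> = ennreal (\<gamma> / unit_ball_vol (Suc n)) * (\<integral>\<^sup>+r. ennreal (distance_weight n lam r)
      * ennreal (cap_volume n (axis_cos lam r (min rho (tangency_time lam r)))) * indicator {0<..rho} r \<partial>lborel)"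
    by (rule nn_integral_cmult) (use hitting_integral(1)[OF assms(3) rho n(2)] in simp)
  also have "\<dots> = ennreal (\<gamma> / unit_ball_vol (Suc n)) * ennreal (unit_ball_vol n / (real n + 1) * (2 * artanh rho))"
    by (simp only: hitting_integral(2)[OF assms(3) rho n(2)])
  also have "2 * artanh rho = h"
    by (simp add: rho_def artanh_tanh_real)
  also have "ennreal (\<gamma> / unit_ball_vol (Suc n)) * ennreal (unit_ball_vol n / (real n + 1) * h)
      = ennreal (\<gamma> * (unit_ball_vol n / (real n + 1) / unit_ball_vol (Suc n)) * h)"
    using assms(2,5) by (simp add: ennreal_mult'[symmetric] mult_ac)
  also have "unit_ball_vol n / (real n + 1) / unit_ball_vol (Suc n)
      = Gamma (real DIM('a) / 2) / (2 * sqrt pi * Gamma ((real DIM('a) + 1) / 2))"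
    unfolding unit_ball_vol_ratio n(1) by (simp add: add.commute)
  finally show ?thesis .
qed

end
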